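(* Let $\Pi$ be a probability measure on $\mathbb{R}^d$ with density $\pi\propto\exp(-U)$, $U\in C^2(\mathbb{R}^d)$, with covariance $\Sigma_\pi$, mode $x^*\in\mathbb{R}^d$ and expectation $\mu_\pi\in\mathbb{R}^d$. Assume there exist symmetric positive definite matrices $\Delta_+,\Delta_-\in\mathbb{R}^{d\times d}$ such that $\Delta_-\preceq\nabla^2U(x)\preceq\Delta_+$ for all $x\in\mathbb{R}^d$, and that $1-(x^*-\mu_\pi)^T\Delta_+(x^*-\mu_\pi)>0$. Define \[ D_\pm=\Delta_\pm(x^*-\mu_\pi)(x^*-\mu_\pi)^T,\qquad c=\sqrt{\det\Delta_-\,\det\Delta_+^{-1}}\le1, \] \[ P_+=c^{-1}\left(\mathbf{I}_d+(1-\mathrm{Tr}(D_+))^{-1}D_+\right)\Delta_+,\qquad P_-=c\left(\mathbf{I}_d+(1-\mathrm{Tr}(D_-))^{-1}D_-\right)\Delta_- . \] Then $P_-\preceq\Sigma_\pi^{-1}\preceq P_+$, and for all $x\in\mathbb{R}^d$ \[ \|\nabla^2U(x)-\Sigma_\pi^{-1}\|\le\max\{\|\Delta_+-P_-\|,\|P_+-\Delta_-\|\}. \]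
   Context: $\preceq$ denotes the Loewner order on symmetric matrices and $\|\cdot\|$ the operator 2-norm. The mode $x^*$ is the maximiser of $\pi$, i.e. the minimiser of $U$. *)

theory Defs
  imports "HOL-Probability.Probability"
begin

definition gradient :: "(real^'d \<Rightarrow> real) \<Rightarrow> real^'d \<Rightarrow> real^'d"
  where "gradient f x = (\<chi> i. frechet_derivative f (at x) (axis i 1))"

text \<open>The entry in row \<open>i\<close> and column \<open>j\<close> is the \<open>j\<close>-th partial derivative of the
  \<open>i\<close>-th partial derivative.\<close>

definition hessian :: "(real^'d \<Rightarrow> real) \<Rightarrow> real^'d \<Rightarrow> real^'d^'d"
  where "hessian f x = matrix (frechet_derivative (gradient f) (at x))"

text \<open>\<^const>\<open>frechet_derivative\<close> is only meaningful where the function is differentiable, so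
  differentiability of \<open>f\<close> and of its gradient is required explicitly.\<close>

definition C2 :: "(real^'d \<Rightarrow> real) \<Rightarrow> bool"
  where "C2 f \<longleftrightarrow> (\<forall>x. f differentiable (at x)) \<and> (\<forall>x. gradient f differentiable (at x)) \<and>
    continuous_on UNIV (hessian f)"

definition symmetric_matrix :: "real^'d^'d \<Rightarrow> bool"
  where "symmetric_matrix A \<longleftrightarrow> transpose A = A"

definition sym_pos_def :: "real^'d^'d \<Rightarrow> bool"
  where "sym_pos_def A \<longleftrightarrow> symmetric_matrix A \<and> (\<forall>v. v \<noteq> 0 \<longrightarrow> 0 < v \<bullet> (A *v v))"

text \<open>The Loewner order relates symmetric matrices only.\<close>

definition loewner_le :: "real^'d^'d \<Rightarrow> real^'d^'d \<Rightarrow> bool"  (infix "\<preceq>\<^sub>L" 50)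
  where "A \<preceq>\<^sub>L B \<longleftrightarrow> symmetric_matrix A \<and> symmetric_matrix B \<and> (\<forall>v. 0 \<le> v \<bullet> ((B - A) *v v))"

definition op_norm :: "real^'d^'d \<Rightarrow> real"
  where "op_norm A = onorm (\<lambda>v. A *v v)"

definition outer_product :: "real^'d \<Rightarrow> real^'d \<Rightarrow> real^'d^'d"
  where "outer_product v w = (\<chi> i j. v $ i * w $ j)"

definition mean_vector :: "(real^'d) measure \<Rightarrow> real^'d"
  where "mean_vector M = (\<integral>x. x \<partial>M)"

definition covariance_matrix :: "(real^'d) measure \<Rightarrow> real^'d^'d"
  where "covariance_matrix M =
    (\<chi> i j. \<integral>x. (x $ i - mean_vector M $ i) * (x $ j - mean_vector M $ j) \<partial>M)"

end

(* Let m = xs - \<mu>, t = m^T \<Delta>m m and c = sqrt (det \<Delta>m / det \<Delta>p).  The covariance satisfies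
   the Brascamp-Lieb and Cramer-Rao bounds \<Delta>m <= S^-1 <= \<Delta>p.  The rank-one corrections only
   enlarge \<Delta>p to Pp, and they keep Pm below \<Delta>m as soon as c / (1 - t) <= 1, so everything
   reduces to t <= 1 - c, where the hypothesis m^T \<Delta>p m < 1 enters.
   Brascamp-Lieb comes from the Prekopa-Leindler inequality applied to the tilted densities, the
   Cramer-Rao bound from the chi-square divergence of infinitesimal translates.
   For c >= 1/4, t <= 1 - c follows by comparing exp(-U) with the two Gaussians of mode xs
   and applying Cauchy-Schwarz to the two differences.  For c <= 1/4 let V be U minus its
   quadratic minorant; Jensen against the translated Gaussian gives
   E V <= ln (1/c) - t/2, stationarity of h |-> E U(X + h) at 0 gives
   E V >= t^2 / (2 (1 - t)), and together 1 / (1 - t) <= 1 + 2 ln (1/c) <= 1/c. *)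
theory Submission
  imports Defs
begin

section \<open>The Prekopa-Leindler inequality\<close>

text \<open>In the direction of a nonzero m the form of \<open>Pm\<close> is exactly c / (1 - t)
  times that of \<open>\<Delta>m\<close>, the equality case of Cauchy-Schwarz. So \<open>Pm\<close>
  stays below \<open>\<Delta>m\<close> only if t <= 1 - c, whereas the hypothesis by itself yields
  merely t < 1, with no margin in terms of c. The two estimates of t have complementary ranges. The
  comparison of masses ends in 4 c t <= 1 - c, which suffices as soon as 4 c >= 1 and becomes void
  as c tends to 0. The entropy estimate 1 / (1 - t) <= 1 + 2 ln (1/c) grows only logarithmically in
  1/c, but it exceeds 1/c near c = 1, where its slope is twice that of 1/c. At c = 1/4 its right
  side is about 3.77, still below 4, so the two ranges meet there. After the mode is moved to the
  origin, the Hessian bounds enter the probabilistic part only as quadratic upper and lower bounds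
  around every point. Gaussians satisfy these with equality, so the same lemmas also supply the
  Gaussian moments.\<close>

lemma emeasure_lborel_translate:
  fixes A :: "real set"
  assumes "A \<in> sets borel"
  shows "(\<lambda>x. c + x) -` A \<in> sets borel" "emeasure lborel ((\<lambda>x. c + x) -` A) = emeasure lborel A"
proof -
  have m: "(\<lambda>x. c + x) \<in> borel_measurable (borel :: real measure)" by measurable
  show "(\<lambda>x. c + x) -` A \<in> sets borel"
    using measurable_sets[OF m assms] by simp
  have "emeasure lborel A = emeasure (distr lborel borel (\<lambda>x. c + x)) A"
    by (simp add: lborel_distr_plus)
  then show "emeasure lborel ((\<lambda>x. c + x) -` A) = emeasure lborel A"
    using assms by (subst (asm) emeasure_distr) auto
qed

text \<open>One-dimensional Brunn-Minkowski. The translates A + b and B + a both lie in S = 2 C.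
  With a close to the top of A and b close to the bottom of B they overlap only inside an interval
  of length at most e, so the measure of their union is almost the sum of the two measures.\<close>

lemma half_sumset_le_bounded:
  fixes A B C :: "real set"
  assumes m: "A \<in> sets borel" "B \<in> sets borel" "C \<in> sets borel"
    and ne: "A \<noteq> {}" "B \<noteq> {}" and bd: "bdd_above A" "bdd_below B"
    and AB: "\<And>x y. x \<in> A \<Longrightarrow> y \<in> B \<Longrightarrow> (x + y) / 2 \<in> C"
  shows "emeasure lborel A + emeasure lborel B \<le> 2 * emeasure lborel C"
proof (rule ennreal_le_epsilon)
  fix e :: real assume "0 < e"
  obtain a where a: "a \<in> A" "Sup A - e/2 < a"
    using less_cSupD[of A "Sup A - e/2"] ne \<open>0 < e\<close> by auto
  obtain b where b: "b \<in> B" "b < Inf B + e/2"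
    using cInf_lessD[of B "Inf B + e/2"] ne \<open>0 < e\<close> by auto
  define S where "S = (\<lambda>x. x / 2) -` C"
  have hm: "(\<lambda>x::real. x / 2) \<in> borel_measurable borel" by measurable
  have S: "S \<in> sets borel"
    unfolding S_def using measurable_sets[OF hm m(3)] by simp
  have "emeasure lborel C = emeasure (density (distr lborel borel (\<lambda>x. x / 2)) (\<lambda>_. ennreal (1/2))) C"
    using lborel_real_affine[of "1/2" 0] by simp
  also have "\<dots> = (1/2) * emeasure lborel S"
    using m hm by (subst emeasure_density) (auto simp: nn_integral_cmult_indicator emeasure_distr S_def ennreal_divide_numeral[of 1, simplified])
  finally have C: "2 * emeasure lborel C = emeasure lborel S"
    by (simp add: mult.assoc[symmetric] ennreal_mult[symmetric] ennreal_times_divide)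
  define A' where "A' = (\<lambda>x. - b + x) -` A"
  define B' where "B' = (\<lambda>x. - a + x) -` B"
  note A' = emeasure_lborel_translate[OF m(1), of "- b", folded A'_def]
  note B' = emeasure_lborel_translate[OF m(2), of "- a", folded B'_def]
  have sub: "A' \<union> B' \<subseteq> S"
  proof
    fix x assume "x \<in> A' \<union> B'"
    then have "((x - b) + b) / 2 \<in> C \<or> (a + (x - a)) / 2 \<in> C"
    proof
      assume "x \<in> A'"
      then show ?thesis using AB[of "x - b" b] b by (simp add: A'_def)
    next
      assume "x \<in> B'"
      then show ?thesis using AB[of a "x - a"] a by (simp add: B'_def)
    qed
    then show "x \<in> S" by (simp add: S_def)
  qed
  have int: "A' \<inter> B' \<subseteq> {a + Inf B .. Sup A + b}"
  proof
    fix x assume "x \<in> A' \<inter> B'"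
    then have "x - b \<in> A" "x - a \<in> B" by (auto simp: A'_def B'_def)
    then have "x - b \<le> Sup A" "Inf B \<le> x - a"
      using bd by (auto intro: cSup_upper cInf_lower)
    then show "x \<in> {a + Inf B .. Sup A + b}" by auto
  qed
  have le: "a + Inf B \<le> Sup A + b"
    using a b bd cSup_upper[of a A] cInf_lower[of b B] by linarith
  have "emeasure lborel A + emeasure lborel B = emeasure lborel A' + emeasure lborel B'"
    using A' B' by simp
  also have "\<dots> = emeasure lborel (A' \<union> B') + emeasure lborel (A' \<inter> B')"
    using A' B' by (subst emeasure_Un_Int[symmetric]) auto
  also have "\<dots> \<le> emeasure lborel S + emeasure lborel {a + Inf B .. Sup A + b}"
    by (intro add_mono emeasure_mono sub int) (use S in auto)
  also have "\<dots> \<le> emeasure lborel S + e"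
    using le a b \<open>0 < e\<close> by (intro add_mono) (auto intro!: ennreal_leI)
  finally show "emeasure lborel A + emeasure lborel B \<le> 2 * emeasure lborel C + e"
    by (simp add: C)
qed

text \<open>Exhaustion by truncations, A from above and B from below. They are anchored at points of
  A and B, so that none of them is empty.\<close>

lemma half_sumset_le:
  fixes A B C :: "real set"
  assumes m: "A \<in> sets borel" "B \<in> sets borel" "C \<in> sets borel"
    and ne: "A \<noteq> {}" "B \<noteq> {}"
    and AB: "\<And>x y. x \<in> A \<Longrightarrow> y \<in> B \<Longrightarrow> (x + y) / 2 \<in> C"
  shows "emeasure lborel A + emeasure lborel B \<le> 2 * emeasure lborel C"
proof -
  obtain a b where ab: "a \<in> A" "b \<in> B" using ne by auto
  define A' where "A' n = A \<inter> {..a + real n}" for n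
  define B' where "B' n = B \<inter> {b - real n..}" for n
  have "emeasure lborel (A' n) + emeasure lborel (B' n) \<le> 2 * emeasure lborel C" for n
  proof (rule half_sumset_le_bounded)
    have "a \<in> A' n" "b \<in> B' n" using ab by (auto simp: A'_def B'_def)
    then show "A' n \<noteq> {}" "B' n \<noteq> {}" by auto
    show "bdd_above (A' n)" unfolding A'_def by (rule bdd_aboveI[of _ "a + real n"]) auto
    show "bdd_below (B' n)" unfolding B'_def by (rule bdd_belowI[of _ "b - real n"]) auto
  qed (use m AB in \<open>auto simp: A'_def B'_def\<close>)
  moreover have "(\<lambda>n. emeasure lborel (A' n)) \<longlonglongrightarrow> emeasure lborel (\<Union>n. A' n)"
    using m by (intro Lim_emeasure_incseq) (auto simp: A'_def incseq_def)
  moreover have "(\<lambda>n. emeasure lborel (B' n)) \<longlonglongrightarrow> emeasure lborel (\<Union>n. B' n)"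
    using m by (intro Lim_emeasure_incseq) (auto simp: B'_def incseq_def)
  moreover have "(\<Union>n. A' n) = A"
  proof -
    have "\<exists>n. x \<le> a + real n" for x
      using real_arch_simple[of "x - a"] by (auto simp: algebra_simps)
    then show ?thesis by (auto simp: A'_def)
  qed
  moreover have "(\<Union>n. B' n) = B"
  proof -
    have "\<exists>n. b - real n \<le> x" for x
      using real_arch_simple[of "b - x"] by (auto simp: algebra_simps)
    then show ?thesis by (auto simp: B'_def)
  qed
  ultimately show ?thesis
    by (intro LIMSEQ_le_const2[OF tendsto_add]) auto
qed

text \<open>Layer-cake formula for functions bounded by 1. Only levels in (0,1) are integrated, and
  at these levels the superlevel sets of functions with supremum 1 are nonempty, as
  \<open>half_sumset_le\<close> demands.\<close>

lemma nn_integral_eq_integral_levels: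
  fixes f :: "real \<Rightarrow> ennreal"
  assumes [measurable]: "f \<in> borel_measurable borel" and le: "\<And>x. f x \<le> 1"
  shows "(\<integral>\<^sup>+x. f x \<partial>lborel) =
    (\<integral>\<^sup>+t. emeasure lborel {x. f x > ennreal t} * indicator {0<..<1} t \<partial>lborel)"
proof -
  have pt: "f x = (\<integral>\<^sup>+t. indicator {t. f x > ennreal t} t * indicator {0<..<1::real} t \<partial>lborel)" for x
  proof -
    obtain r where r: "f x = ennreal r" "0 \<le> r"
      using le[of x] by (cases "f x") (auto simp: top_unique)
    then have r1: "r \<le> 1" using le[of x] by simp
    have "(\<integral>\<^sup>+t. indicator {t. f x > ennreal t} t * indicator {0<..<1::real} t \<partial>lborel)
      = (\<integral>\<^sup>+t. indicator {0<..<r} t \<partial>lborel)"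
      using r r1 by (intro nn_integral_cong) (auto simp: indicator_def ennreal_less_iff)
    also have "\<dots> = f x" using r by simp
    finally show ?thesis by simp
  qed
  have "(\<integral>\<^sup>+x. f x \<partial>lborel)
    = (\<integral>\<^sup>+x. (\<integral>\<^sup>+t. indicator {t. f x > ennreal t} t * indicator {0<..<1::real} t \<partial>lborel) \<partial>lborel)"
    using pt by (intro nn_integral_cong) simp
  also have "\<dots> = (\<integral>\<^sup>+t. (\<integral>\<^sup>+x. indicator {t. f x > ennreal t} t * indicator {0<..<1::real} t \<partial>lborel) \<partial>lborel)"
    by (rule lborel_pair.Fubini') measurable
  also have "\<dots> = (\<integral>\<^sup>+t. emeasure lborel {x. f x > ennreal t} * indicator {0<..<1} t \<partial>lborel)"
  proof (rule nn_integral_cong)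
    fix t :: real
    have "(\<integral>\<^sup>+x. indicator {t. f x > ennreal t} t * indicator {0<..<1::real} t \<partial>lborel)
      = (\<integral>\<^sup>+x. indicator {0<..<1::real} t * indicator {x. f x > ennreal t} x \<partial>lborel)"
      by (intro nn_integral_cong) (auto simp: indicator_def)
    also have "\<dots> = emeasure lborel {x. f x > ennreal t} * indicator {0<..<1} t"
      by (subst nn_integral_cmult_indicator) (auto simp: mult.commute)
    finally show "(\<integral>\<^sup>+x. indicator {t. f x > ennreal t} t * indicator {0<..<1::real} t \<partial>lborel)
      = emeasure lborel {x. f x > ennreal t} * indicator {0<..<1} t" .
  qed
  finally show ?thesis .
qed

lemma ennreal_four_mult_le_square_sum:
  fixes a b :: ennreal
  shows "4 * (a * b) \<le> (a + b)\<^sup>2"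
proof (cases "a = \<top> \<or> b = \<top>")
  case True
  then show ?thesis by (auto simp: power2_eq_square ennreal_top_mult ennreal_mult_top)
next
  case False
  then obtain x y where xy: "a = ennreal x" "b = ennreal y" "0 \<le> x" "0 \<le> y"
    by (cases a; cases b) auto
  have "4 * (x * y) \<le> (x + y)\<^sup>2"
    using zero_le_power2[of "x - y"] by (simp add: power2_eq_square algebra_simps)
  then show ?thesis
    using xy by (simp add: ennreal_plus[symmetric] ennreal_mult[symmetric] ennreal_power
        ennreal_numeral[symmetric] del: ennreal_plus ennreal_numeral)
qed

lemma ennreal_less_of_square_less:
  fixes t h :: ennreal
  assumes "t < a" "t < b" "a * b \<le> h\<^sup>2"
  shows "t < h"
proof (rule ccontr)
  assume "\<not> t < h"
  then have "h\<^sup>2 \<le> t * t" by (simp add: power2_eq_square mult_mono)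
  also have "t * t < a * b"
  proof (cases "t = 0")
    case True
    then show ?thesis using assms by (simp add: ennreal_zero_less_mult_iff)
  next
    case False
    then have "t * t < t * b"
      using assms by (intro ennreal_mult_strict_left_mono) (auto simp: zero_less_iff_neq_zero dest: less_le_trans[OF _ top_greatest])
    also have "\<dots> \<le> a * b" using assms by (intro mult_right_mono) auto
    finally show ?thesis .
  qed
  finally show False using assms(3) by simp
qed

text \<open>With both suprema equal to 1 the superlevel sets of f and g are nonempty at the same
  levels. The sumset inequality at each level integrates to an arithmetic mean bound, and
  \<open>ennreal_four_mult_le_square_sum\<close> passes to the geometric mean.\<close>

lemma prekopa_leindler_real_normalized:
  fixes f g h :: "real \<Rightarrow> ennreal"
  assumes [measurable]: "f \<in> borel_measurable borel" "g \<in> borel_measurable borel" "h \<in> borel_measurable borel"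
    and le: "\<And>x. f x \<le> 1" "\<And>x. g x \<le> 1"
    and ex: "\<And>t. t < 1 \<Longrightarrow> \<exists>x. t < f x" "\<And>t. t < 1 \<Longrightarrow> \<exists>x. t < g x"
    and fgh: "\<And>x y. f x * g y \<le> (h ((x + y) / 2))\<^sup>2"
  shows "(\<integral>\<^sup>+x. f x \<partial>lborel) * (\<integral>\<^sup>+x. g x \<partial>lborel) \<le> (\<integral>\<^sup>+x. h x \<partial>lborel)\<^sup>2"
proof -
  \<comment> \<open>Capping h at 1 leaves its superlevel sets unchanged at all levels below 1 and
    makes the layer-cake formula applicable.\<close>
  define k where "k x = min (h x) 1" for x
  have [measurable]: "k \<in> borel_measurable borel" unfolding k_def by measurable
  let ?L = "\<lambda>f t. emeasure lborel {x. f x > ennreal t}"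
  have "?L f t + ?L g t \<le> 2 * ?L k t" if t: "t \<in> {0<..<1}" for t
  proof (rule half_sumset_le)
    have "ennreal t < 1" using t by (simp add: ennreal_less_one_iff)
    then show "{x. ennreal t < f x} \<noteq> {}" "{x. ennreal t < g x} \<noteq> {}"
      using ex by blast+
    show "(x + y) / 2 \<in> {x. ennreal t < k x}"
      if "x \<in> {x. ennreal t < f x}" "y \<in> {x. ennreal t < g x}" for x y
      using ennreal_less_of_square_less[OF _ _ fgh, of "ennreal t" x y] that \<open>ennreal t < 1\<close>
      by (simp add: k_def)
  qed measurable
  then have "(\<integral>\<^sup>+t. (?L f t + ?L g t) * indicator {0<..<1} t \<partial>lborel)
    \<le> (\<integral>\<^sup>+t. 2 * (?L k t * indicator {0<..<1} t) \<partial>lborel)"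
    by (intro nn_integral_mono) (auto simp: indicator_def)
  also have "\<dots> = 2 * (\<integral>\<^sup>+x. k x \<partial>lborel)"
    by (subst nn_integral_cmult) (auto simp: nn_integral_eq_integral_levels k_def)
  also have "(\<integral>\<^sup>+t. (?L f t + ?L g t) * indicator {0<..<1} t \<partial>lborel)
    = (\<integral>\<^sup>+x. f x \<partial>lborel) + (\<integral>\<^sup>+x. g x \<partial>lborel)"
    by (simp add: distrib_right nn_integral_add nn_integral_eq_integral_levels[of f]
        nn_integral_eq_integral_levels[of g] le)
  also have "(\<integral>\<^sup>+x. k x \<partial>lborel) \<le> (\<integral>\<^sup>+x. h x \<partial>lborel)"
    by (intro nn_integral_mono) (simp add: k_def)
  finally have "(\<integral>\<^sup>+x. f x \<partial>lborel) + (\<integral>\<^sup>+x. g x \<partial>lborel) \<le> 2 * (\<integral>\<^sup>+x. h x \<partial>lborel)"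
    by (simp add: mult_left_mono)
  then have "((\<integral>\<^sup>+x. f x \<partial>lborel) + (\<integral>\<^sup>+x. g x \<partial>lborel))\<^sup>2 \<le> (2 * (\<integral>\<^sup>+x. h x \<partial>lborel))\<^sup>2"
    by (rule power_mono) simp
  then have "4 * ((\<integral>\<^sup>+x. f x \<partial>lborel) * (\<integral>\<^sup>+x. g x \<partial>lborel)) \<le> 4 * (\<integral>\<^sup>+x. h x \<partial>lborel)\<^sup>2"
    using ennreal_four_mult_le_square_sum order_trans by (fastforce simp: power_mult_distrib)
  then show ?thesis
    by (subst (asm) ennreal_mult_le_mult_iff) auto
qed

text \<open>The claim is homogeneous: dividing f and g by their suprema p and q, and h by the
  geometric mean s of p and q, preserves the hypothesis and reduces to the normalized case. A
  vanishing supremum makes the left side zero.\<close>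

lemma prekopa_leindler_real_bounded:
  fixes f g h :: "real \<Rightarrow> ennreal"
  assumes [measurable]: "f \<in> borel_measurable borel" "g \<in> borel_measurable borel" "h \<in> borel_measurable borel"
    and le: "\<And>x. f x \<le> of_nat N" "\<And>x. g x \<le> of_nat N"
    and fgh: "\<And>x y. f x * g y \<le> (h ((x + y) / 2))\<^sup>2"
  shows "(\<integral>\<^sup>+x. f x \<partial>lborel) * (\<integral>\<^sup>+x. g x \<partial>lborel) \<le> (\<integral>\<^sup>+x. h x \<partial>lborel)\<^sup>2"
proof -
  define a b where "a = (SUP x. f x)" and "b = (SUP x. g x)"
  have fa: "f x \<le> a" and gb: "g x \<le> b" for x
    unfolding a_def b_def by (auto intro: SUP_upper)
  have fin: "a \<noteq> \<top>" "b \<noteq> \<top>"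
    using SUP_least[of UNIV f "of_nat N"] SUP_least[of UNIV g "of_nat N"] le
    by (auto simp flip: a_def b_def simp: top_unique)
  show ?thesis
  proof (cases "a = 0 \<or> b = 0")
    case True
    then have "(\<forall>x. f x = 0) \<or> (\<forall>x. g x = 0)" using fa gb by (metis le_zero_eq)
    then show ?thesis by auto
  next
    case False
    then obtain p q where p: "a = ennreal p" "0 < p" and q: "b = ennreal q" "0 < q"
      using fin by (cases a; cases b) (auto simp: zero_less_iff_neq_zero[symmetric])
    define s where "s = sqrt (p * q)"
    have s: "0 < s" "s\<^sup>2 = p * q" using p q by (auto simp: s_def)
    have inv: "ennreal c * (ennreal (1 / c) * z) = z" if "0 < c" for c z
      using that by (simp add: mult.assoc[symmetric] ennreal_mult[symmetric])
    have ex: "\<exists>x. t < ennreal (1 / c) * u x"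
      if c: "0 < c" and u: "(SUP x. u x) = ennreal c" and t: "t < 1" for c t and u :: "real \<Rightarrow> ennreal"
    proof -
      have "ennreal c * t < ennreal c * 1"
        using c t by (intro ennreal_mult_strict_left_mono) auto
      then obtain x where "ennreal c * t < u x"
        using u less_SUP_iff[of "ennreal c * t" u UNIV] by auto
      then have "ennreal (1 / c) * (ennreal c * t) < ennreal (1 / c) * u x"
        using c by (intro ennreal_mult_strict_left_mono) auto
      then show ?thesis using inv[of "1 / c" t] c by auto
    qed
    have "(\<integral>\<^sup>+x. ennreal (1 / p) * f x \<partial>lborel) * (\<integral>\<^sup>+x. ennreal (1 / q) * g x \<partial>lborel)
      \<le> (\<integral>\<^sup>+x. ennreal (1 / s) * h x \<partial>lborel)\<^sup>2"
    proof (rule prekopa_leindler_real_normalized)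
      show "ennreal (1 / p) * f x \<le> 1" for x
        using mult_left_mono[OF fa[of x], of "ennreal (1 / p)"] p by (simp add: ennreal_mult[symmetric])
      show "ennreal (1 / q) * g x \<le> 1" for x
        using mult_left_mono[OF gb[of x], of "ennreal (1 / q)"] q by (simp add: ennreal_mult[symmetric])
      show "t < 1 \<Longrightarrow> \<exists>x. t < ennreal (1 / p) * f x" for t
        by (rule ex) (use p a_def in auto)
      show "t < 1 \<Longrightarrow> \<exists>x. t < ennreal (1 / q) * g x" for t
        by (rule ex) (use q b_def in auto)
      show "ennreal (1 / p) * f x * (ennreal (1 / q) * g y) \<le> (ennreal (1 / s) * h ((x + y) / 2))\<^sup>2" for x y
      proof -
        have "ennreal (1 / p) * f x * (ennreal (1 / q) * g y) = ennreal (1 / (p * q)) * (f x * g y)"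
          using p q ennreal_mult[of "1 / p" "1 / q"] by (simp add: mult_ac)
        also have "\<dots> \<le> ennreal (1 / (p * q)) * (h ((x + y) / 2))\<^sup>2"
          by (intro mult_left_mono fgh) simp
        also have "\<dots> = (ennreal (1 / s) * h ((x + y) / 2))\<^sup>2"
          using s by (simp add: power_mult_distrib ennreal_power power_divide)
        finally show ?thesis .
      qed
    qed measurable
    then have "ennreal (1 / p) * (\<integral>\<^sup>+x. f x \<partial>lborel) * (ennreal (1 / q) * (\<integral>\<^sup>+x. g x \<partial>lborel))
      \<le> (ennreal (1 / s) * (\<integral>\<^sup>+x. h x \<partial>lborel))\<^sup>2"
      by (simp add: nn_integral_cmult)
    also have "ennreal (1 / p) * (\<integral>\<^sup>+x. f x \<partial>lborel) * (ennreal (1 / q) * (\<integral>\<^sup>+x. g x \<partial>lborel))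
      = ennreal (1 / (p * q)) * ((\<integral>\<^sup>+x. f x \<partial>lborel) * (\<integral>\<^sup>+x. g x \<partial>lborel))"
      using p q ennreal_mult[of "1 / p" "1 / q"] by (simp add: mult_ac)
    also have "(ennreal (1 / s) * (\<integral>\<^sup>+x. h x \<partial>lborel))\<^sup>2 = ennreal (1 / (p * q)) * (\<integral>\<^sup>+x. h x \<partial>lborel)\<^sup>2"
      using s by (simp add: power_mult_distrib ennreal_power power_divide)
    finally show ?thesis
      using mult_pos_pos[OF p(2) q(2)] by (subst (asm) ennreal_mult_le_mult_iff) (auto simp: ennreal_eq_0_iff)
  qed
qed

text \<open>Truncation of f and g at n and monotone convergence. Vanishing integrals are treated
  separately because multiplication of extended reals is discontinuous at zero times
  infinity.\<close>

lemma prekopa_leindler_real: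
  fixes f g h :: "real \<Rightarrow> ennreal"
  assumes [measurable]: "f \<in> borel_measurable borel" "g \<in> borel_measurable borel" "h \<in> borel_measurable borel"
    and fgh: "\<And>x y. f x * g y \<le> (h ((x + y) / 2))\<^sup>2"
  shows "(\<integral>\<^sup>+x. f x \<partial>lborel) * (\<integral>\<^sup>+x. g x \<partial>lborel) \<le> (\<integral>\<^sup>+x. h x \<partial>lborel)\<^sup>2"
proof (cases "(\<integral>\<^sup>+x. f x \<partial>lborel) = 0 \<or> (\<integral>\<^sup>+x. g x \<partial>lborel) = 0")
  case True
  then show ?thesis by auto
next
  case False
  have lim: "(\<lambda>n. \<integral>\<^sup>+x. min (u x) (of_nat n) \<partial>lborel) \<longlonglongrightarrow> (\<integral>\<^sup>+x. u x \<partial>lborel)"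
    if [measurable]: "u \<in> borel_measurable borel" for u :: "real \<Rightarrow> ennreal"
  proof (rule nn_integral_LIMSEQ)
    show "incseq (\<lambda>n x. min (u x) (of_nat n :: ennreal))"
      by (auto simp: incseq_def le_fun_def intro: min.coboundedI2)
    show "(\<lambda>n. min (u x) (of_nat n)) \<longlonglongrightarrow> u x" for x
    proof -
      have "(\<lambda>n. min (u x) (of_nat n)) \<longlonglongrightarrow> min (u x) \<top>"
        by (intro tendsto_min tendsto_const of_nat_tendsto_top_ennreal)
      then show ?thesis by simp
    qed
  qed measurable
  have "(\<lambda>n. (\<integral>\<^sup>+x. min (f x) (of_nat n) \<partial>lborel) * (\<integral>\<^sup>+x. min (g x) (of_nat n) \<partial>lborel))
    \<longlonglongrightarrow> (\<integral>\<^sup>+x. f x \<partial>lborel) * (\<integral>\<^sup>+x. g x \<partial>lborel)"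
    using False by (intro tendsto_mult_ennreal lim) auto
  moreover have "(\<integral>\<^sup>+x. min (f x) (of_nat n) \<partial>lborel) * (\<integral>\<^sup>+x. min (g x) (of_nat n) \<partial>lborel)
    \<le> (\<integral>\<^sup>+x. h x \<partial>lborel)\<^sup>2" for n
  proof (rule prekopa_leindler_real_bounded[where N = n])
    show "min (f x) (of_nat n) * min (g y) (of_nat n) \<le> (h ((x + y) / 2))\<^sup>2" for x y
      by (rule order_trans[OF _ fgh[of x y]]) (intro mult_mono, auto)
  qed (auto simp: min.coboundedI2)
  ultimately show ?thesis by (intro LIMSEQ_le_const2) auto
qed

text \<open>Integrating out one coordinate preserves the hypothesis, so the one-dimensional case
  propagates to finite products.\<close>

lemma prekopa_leindler_PiM:
  fixes f g h :: "('i \<Rightarrow> real) \<Rightarrow> ennreal"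
  assumes "finite I"
    and "f \<in> borel_measurable (Pi\<^sub>M I (\<lambda>_. lborel))" "g \<in> borel_measurable (Pi\<^sub>M I (\<lambda>_. lborel))"
      "h \<in> borel_measurable (Pi\<^sub>M I (\<lambda>_. lborel))"
    and "\<And>x y. x \<in> extensional I \<Longrightarrow> y \<in> extensional I \<Longrightarrow>
      f x * g y \<le> (h (restrict (\<lambda>i. (x i + y i) / 2) I))\<^sup>2"
  shows "(\<integral>\<^sup>+x. f x \<partial>Pi\<^sub>M I (\<lambda>_. lborel)) * (\<integral>\<^sup>+x. g x \<partial>Pi\<^sub>M I (\<lambda>_. lborel))
    \<le> (\<integral>\<^sup>+x. h x \<partial>Pi\<^sub>M I (\<lambda>_. lborel))\<^sup>2"
  using assms
proof (induction I arbitrary: f g h rule: finite_induct)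
  case empty
  \<comment> \<open>The empty product is a one-point space whose only point is the everywhere
    undefined function.\<close>
  then show ?case
    using empty.prems(4)[of "\<lambda>_. undefined" "\<lambda>_. undefined"]
    by (simp add: PiM_empty nn_integral_count_space_finite restrict_def)
next
  case (insert i I)
  interpret product_sigma_finite "\<lambda>_::'i. lborel :: real measure" by standard
  interpret I: finite_product_sigma_finite "\<lambda>_::'i. lborel :: real measure" I
    by standard (rule insert.hyps(1))
  note [measurable] = insert.prems(1-3)
  have app: "(\<lambda>x. x(i := y)) \<in> Pi\<^sub>M I (\<lambda>_. lborel) \<rightarrow>\<^sub>M Pi\<^sub>M (insert i I) (\<lambda>_. lborel)" for y :: real
    by measurable
  have step: "(\<integral>\<^sup>+x. f (x(i := a)) \<partial>Pi\<^sub>M I (\<lambda>_. lborel)) * (\<integral>\<^sup>+x. g (x(i := b)) \<partial>Pi\<^sub>M I (\<lambda>_. lborel))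
    \<le> (\<integral>\<^sup>+x. h (x(i := (a + b) / 2)) \<partial>Pi\<^sub>M I (\<lambda>_. lborel))\<^sup>2" for a b
  proof (rule insert.IH)
    fix x y :: "'i \<Rightarrow> real" assume xy: "x \<in> extensional I" "y \<in> extensional I"
    have "f (x(i := a)) * g (y(i := b))
      \<le> (h (restrict (\<lambda>j. ((x(i := a)) j + (y(i := b)) j) / 2) (insert i I)))\<^sup>2"
      using xy by (intro insert.prems) (auto simp: extensional_def)
    also have "restrict (\<lambda>j. ((x(i := a)) j + (y(i := b)) j) / 2) (insert i I)
      = (restrict (\<lambda>j. (x j + y j) / 2) I)(i := (a + b) / 2)"
      using insert.hyps by (auto simp: restrict_def fun_eq_iff)
    finally show "f (x(i := a)) * g (y(i := b))
      \<le> (h ((restrict (\<lambda>j. (x j + y j) / 2) I)(i := (a + b) / 2)))\<^sup>2" .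
  qed (use app in measurable)
  show ?case
    unfolding product_nn_integral_insert_rev[OF insert.hyps(1,2) insert.prems(1)]
      product_nn_integral_insert_rev[OF insert.hyps(1,2) insert.prems(2)]
      product_nn_integral_insert_rev[OF insert.hyps(1,2) insert.prems(3)]
    by (intro prekopa_leindler_real step) measurable
qed

section \<open>Lebesgue measure on vectors as a product of lines\<close>

lemma prod_Basis_vec:
  fixes f :: "real^'d \<Rightarrow> 'a::comm_monoid_mult"
  shows "(\<Prod>b\<in>Basis. f b) = (\<Prod>i\<in>UNIV. f (axis i 1))"
proof -
  have B: "(Basis :: (real^'d) set) = range (\<lambda>i. axis i 1)"
    by (auto simp: Basis_vec_def)
  have "inj (\<lambda>i::'d. axis i (1::real))"
    by (auto simp: inj_on_def axis_eq_axis)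
  then show ?thesis unfolding B by (simp add: prod.reindex)
qed

lemma measurable_vec_lambda:
  "vec_lambda \<in> Pi\<^sub>M UNIV (\<lambda>_. lborel) \<rightarrow>\<^sub>M (borel :: (real^'d) measure)"
  by (subst borel_measurable_euclidean_space) (auto simp: Basis_vec_def inner_axis)

lemma lborel_eq_PiM_vec:
  "(lborel :: (real^'d) measure) = distr (Pi\<^sub>M UNIV (\<lambda>_. lborel)) borel vec_lambda"
proof (rule lborel_eqI)
  interpret product_sigma_finite "\<lambda>_::'d. lborel :: real measure" by standard
  note m = measurable_vec_lambda
  fix l u :: "real^'d" assume le: "\<And>b. b \<in> Basis \<Longrightarrow> l \<bullet> b \<le> u \<bullet> b"
  have le': "l $ i \<le> u $ i" for i
    using le[of "axis i 1"] by (simp add: inner_axis axis_in_Basis_iff)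
  have "emeasure (distr (Pi\<^sub>M UNIV (\<lambda>_. lborel)) borel vec_lambda) (box l u)
    = emeasure (Pi\<^sub>M UNIV (\<lambda>_. lborel)) (Pi\<^sub>E UNIV (\<lambda>i. {l $ i <..< u $ i}))"
    using m by (subst emeasure_distr) (auto simp: space_PiM mem_box_cart PiE_UNIV_domain Pi_def vimage_def intro!: arg_cong2[where f=emeasure])
  also have "\<dots> = (\<Prod>i\<in>UNIV. ennreal (u $ i - l $ i))"
    by (subst emeasure_PiM) (auto simp: le')
  also have "\<dots> = (\<Prod>i\<in>UNIV. (u - l) $ i)"
    by (simp add: prod_ennreal le')
  also have "\<dots> = (\<Prod>b\<in>Basis. (u - l) \<bullet> b)"
    by (simp add: prod_Basis_vec inner_axis)
  finally show "emeasure (distr (Pi\<^sub>M UNIV (\<lambda>_. lborel)) borel vec_lambda) (box l u)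
    = (\<Prod>b\<in>Basis. (u - l) \<bullet> b)" .
qed simp

lemma nn_integral_lborel_vec:
  fixes f :: "real^'d \<Rightarrow> ennreal"
  assumes "f \<in> borel_measurable borel"
  shows "(\<integral>\<^sup>+x. f x \<partial>lborel) = (\<integral>\<^sup>+x. f (vec_lambda x) \<partial>Pi\<^sub>M UNIV (\<lambda>_. lborel))"
  by (subst lborel_eq_PiM_vec) (simp add: nn_integral_distr measurable_vec_lambda assms)

theorem prekopa_leindler:
  fixes f g h :: "real^'d \<Rightarrow> ennreal"
  assumes "f \<in> borel_measurable borel" "g \<in> borel_measurable borel" "h \<in> borel_measurable borel"
    and fgh: "\<And>x y. f x * g y \<le> (h ((1/2) *\<^sub>R (x + y)))\<^sup>2"
  shows "(\<integral>\<^sup>+x. f x \<partial>lborel) * (\<integral>\<^sup>+x. g x \<partial>lborel) \<le> (\<integral>\<^sup>+x. h x \<partial>lborel)\<^sup>2"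
  unfolding nn_integral_lborel_vec[OF assms(1)] nn_integral_lborel_vec[OF assms(2)]
    nn_integral_lborel_vec[OF assms(3)]
proof (rule prekopa_leindler_PiM)
  fix x y :: "'d \<Rightarrow> real"
  have "(1/2) *\<^sub>R (vec_lambda x + vec_lambda y) = vec_lambda (\<lambda>i. (x i + y i) / 2)"
    by (simp add: vec_eq_iff)
  then show "f (vec_lambda x) * g (vec_lambda y)
    \<le> (h (vec_lambda (restrict (\<lambda>i. (x i + y i) / 2) UNIV)))\<^sup>2"
    using fgh[of "vec_lambda x" "vec_lambda y"] by (simp add: restrict_def)
qed (use assms measurable_vec_lambda in \<open>auto intro: measurable_compose\<close>)

section \<open>Linear change of variables\<close>

lemma borel_measurable_matrix_vector_mult [measurable]:
  fixes A :: "real^'d^'e"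
  shows "(\<lambda>x. A *v x) \<in> borel_measurable borel"
  by (intro borel_measurable_continuous_onI linear_continuous_on matrix_vector_mul_bounded_linear)

lemma nn_integral_lborel_diagonal:
  fixes A :: "real^'d^'d" and F :: "real^'d \<Rightarrow> ennreal"
  assumes diag: "\<And>i j. i \<noteq> j \<Longrightarrow> A $ i $ j = 0" and det: "det A \<noteq> 0"
    and [measurable]: "F \<in> borel_measurable borel"
  shows "(\<integral>\<^sup>+y. F y \<partial>lborel) = ennreal \<bar>det A\<bar> * (\<integral>\<^sup>+z. F (A *v z) \<partial>lborel)"
proof -
  define c where "c b = (A *v b) \<bullet> b" for b
  have Ab: "A *v axis i 1 = A $ i $ i *\<^sub>R axis i 1" for i
    using diag by (auto simp: vec_eq_iff matrix_vector_mult_def axis_def if_distrib cong: if_cong)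
  have c: "c (axis i 1) = A $ i $ i" for i
    by (simp add: c_def Ab inner_axis_axis)
  have detA: "det A = (\<Prod>i\<in>UNIV. A $ i $ i)"
    using diag by (rule det_diagonal)
  have nz: "c j \<noteq> 0" if "j \<in> Basis" for j
    using that det by (auto simp: Basis_vec_def c detA)
  have T: "(\<lambda>x. 0 + (\<Sum>j\<in>Basis. (c j * (x \<bullet> j)) *\<^sub>R j)) = (\<lambda>x. A *v x)"
  proof
    fix x
    have "(\<Sum>j\<in>Basis. (c j * (x \<bullet> j)) *\<^sub>R j) = (\<Sum>j\<in>Basis. (x \<bullet> j) *\<^sub>R (A *v j))"
      by (intro sum.cong) (auto simp: Basis_vec_def Ab c)
    also have "\<dots> = A *v (\<Sum>j\<in>Basis. (x \<bullet> j) *\<^sub>R j)"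
      by (simp add: linear_sum[OF matrix_vector_mul_linear] matrix_vector_mult_scaleR)
    finally show "0 + (\<Sum>j\<in>Basis. (c j * (x \<bullet> j)) *\<^sub>R j) = A *v x"
      by (simp add: euclidean_representation)
  qed
  have "(lborel :: (real^'d) measure) = density (distr lborel borel (\<lambda>x. A *v x)) (\<lambda>_. (\<Prod>j\<in>Basis. \<bar>c j\<bar>))"
    using lborel_affine_euclidean[of c 0] nz unfolding T by blast
  also have "(\<Prod>j\<in>Basis. \<bar>c j\<bar>) = \<bar>det A\<bar>"
    by (simp add: prod_Basis_vec c detA abs_prod)
  finally have "(\<integral>\<^sup>+y. F y \<partial>lborel)
    = (\<integral>\<^sup>+y. F y \<partial>density (distr lborel borel (\<lambda>x. A *v x)) (\<lambda>_. \<bar>det A\<bar>))"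
    by simp
  also have "\<dots> = ennreal \<bar>det A\<bar> * (\<integral>\<^sup>+z. F (A *v z) \<partial>lborel)"
    by (simp add: nn_integral_density nn_integral_distr nn_integral_cmult)
  finally show ?thesis .
qed

lemma nn_integral_lborel_permute:
  fixes F :: "real^'d \<Rightarrow> ennreal" and p :: "'d \<Rightarrow> 'd"
  assumes p: "p permutes UNIV" and [measurable]: "F \<in> borel_measurable borel"
  shows "(\<integral>\<^sup>+y. F y \<partial>lborel) = (\<integral>\<^sup>+z. F (\<chi> i. z $ p i) \<partial>lborel)"
proof -
  have m: "(\<lambda>z::real^'d. \<chi> i. z $ p i) \<in> borel_measurable borel"
    by (subst borel_measurable_euclidean_space)
      (auto simp: Basis_vec_def inner_axis intro!: borel_measurable_continuous_onI continuous_intros)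
  have "(lborel :: (real^'d) measure) = distr lborel borel (\<lambda>z. \<chi> i. z $ p i)"
  proof (rule lborel_eqI)
    fix l u :: "real^'d" assume le: "\<And>b. b \<in> Basis \<Longrightarrow> l \<bullet> b \<le> u \<bullet> b"
    have le': "l $ i \<le> u $ i" for i
      using le[of "axis i 1"] by (simp add: inner_axis axis_in_Basis_iff)
    let ?q = "\<lambda>x::real^'d. \<chi> i. x $ inv p i"
    have "(\<lambda>z. \<chi> i. z $ p i) -` box l u = box (?q l) (?q u)"
      using permutes_inverses[OF p] by (auto simp: mem_box_cart) metis+
    then have "emeasure (distr lborel borel (\<lambda>z. \<chi> i. z $ p i)) (box l u) = emeasure lborel (box (?q l) (?q u))"
      using m by (subst emeasure_distr) auto
    also have "\<dots> = (\<Prod>b\<in>Basis. (?q u - ?q l) \<bullet> b)"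
      by (rule emeasure_lborel_box) (auto simp: Basis_vec_def inner_axis le')
    also have "(\<Prod>b\<in>Basis. (?q u - ?q l) \<bullet> b) = (\<Prod>i\<in>UNIV. u $ inv p i - l $ inv p i)"
      by (simp add: prod_Basis_vec inner_axis)
    also have "\<dots> = (\<Prod>i\<in>UNIV. u $ i - l $ i)"
      using prod.permute[OF permutes_inv[OF p], of "\<lambda>i. u $ i - l $ i"] by (simp add: o_def)
    also have "\<dots> = (\<Prod>b\<in>Basis. (u - l) \<bullet> b)"
      by (simp add: prod_Basis_vec inner_axis)
    finally show "emeasure (distr lborel borel (\<lambda>z. \<chi> i. z $ p i)) (box l u) = (\<Prod>b\<in>Basis. (u - l) \<bullet> b)" .
  qed simp
  then have "(\<integral>\<^sup>+y. F y \<partial>lborel) = (\<integral>\<^sup>+y. F y \<partial>distr lborel borel (\<lambda>z. \<chi> i. z $ p i))"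
    by simp
  then show ?thesis using m by (simp add: nn_integral_distr)
qed

text \<open>If coordinate m is integrated first, the coordinate n is a constant, and the shear is a
  mere translation of the inner variable by it.\<close>

lemma nn_integral_lborel_shear:
  fixes F :: "real^'d \<Rightarrow> ennreal"
  assumes "m \<noteq> n" and F[measurable]: "F \<in> borel_measurable borel"
  shows "(\<integral>\<^sup>+y. F y \<partial>lborel) = (\<integral>\<^sup>+z. F (z + (z $ n) *\<^sub>R axis m 1) \<partial>lborel)"
proof -
  interpret product_sigma_finite "\<lambda>_::'d. lborel :: real measure" by standard
  let ?I = "UNIV - {m}"
  have ins: "insert m ?I = UNIV" by auto
  note [measurable] = measurable_vec_lambda
  define G where "G z = F (z + (z $ n) *\<^sub>R axis m 1)" for z
  have "(\<lambda>z. z + (z $ n) *\<^sub>R axis m 1) \<in> borel_measurable (borel :: (real^'d) measure)"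
    by (intro borel_measurable_continuous_onI continuous_intros)
  then have G[measurable]: "G \<in> borel_measurable borel"
    unfolding G_def by measurable
  have split: "(\<integral>\<^sup>+x. H (vec_lambda x) \<partial>Pi\<^sub>M UNIV (\<lambda>_. lborel))
    = (\<integral>\<^sup>+x. (\<integral>\<^sup>+y. H (vec_lambda (x(m := y))) \<partial>lborel) \<partial>Pi\<^sub>M ?I (\<lambda>_. lborel))"
    if [measurable]: "H \<in> borel_measurable borel" for H :: "real^'d \<Rightarrow> ennreal"
    using product_nn_integral_insert[of ?I m "\<lambda>x. H (vec_lambda x)"] unfolding ins by simp
  have "(\<integral>\<^sup>+y. G (vec_lambda (x(m := y))) \<partial>lborel) = (\<integral>\<^sup>+y. F (vec_lambda (x(m := y))) \<partial>lborel)" for x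
  proof -
    have mx: "(\<lambda>y. vec_lambda (x(m := y))) \<in> borel_measurable (borel :: real measure)"
      by (subst borel_measurable_euclidean_space) (auto simp: Basis_vec_def inner_axis)
    have "vec_lambda (x(m := y)) + (vec_lambda (x(m := y)) $ n) *\<^sub>R axis m 1
      = vec_lambda (x(m := x n + y))" for y
      using assms(1) by (auto simp: vec_eq_iff axis_def)
    then have "(\<integral>\<^sup>+y. G (vec_lambda (x(m := y))) \<partial>lborel)
      = (\<integral>\<^sup>+y. F (vec_lambda (x(m := x n + y))) \<partial>lborel)"
      by (simp add: G_def)
    also have "\<dots> = (\<integral>\<^sup>+y. F (vec_lambda (x(m := y))) \<partial>distr lborel borel (\<lambda>y. x n + y))"
      using mx by (subst nn_integral_distr) auto
    finally show ?thesis by (simp add: lborel_distr_plus)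
  qed
  then have "(\<integral>\<^sup>+y. F y \<partial>lborel) = (\<integral>\<^sup>+z. G z \<partial>lborel)"
    unfolding nn_integral_lborel_vec[OF F] nn_integral_lborel_vec[OF G] split[OF F] split[OF G]
    by simp
  then show ?thesis by (simp only: G_def)
qed

text \<open>Induction over elementary matrices. The predicate \<open>P\<close> carries the premise
  that the determinant is nonzero: matrices with a zero row then satisfy it vacuously, and in a
  product the premise passes to both factors.\<close>

lemma nn_integral_lborel_linear:
  fixes A :: "real^'d^'d" and F :: "real^'d \<Rightarrow> ennreal"
  assumes "det A \<noteq> 0" "F \<in> borel_measurable borel"
  shows "(\<integral>\<^sup>+y. F y \<partial>lborel) = ennreal \<bar>det A\<bar> * (\<integral>\<^sup>+z. F (A *v z) \<partial>lborel)"
proof -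
  define P where "P A \<longleftrightarrow> det A \<noteq> 0 \<longrightarrow> (\<forall>F \<in> borel_measurable borel.
    (\<integral>\<^sup>+y. F y \<partial>lborel) = ennreal \<bar>det A\<bar> * (\<integral>\<^sup>+z. F (A *v z) \<partial>lborel))"
    for A :: "real^'d^'d"
  have "P A"
  proof (rule induct_matrix_elementary_alt[of P])
    fix A B assume AB: "P A" "P B"
    show "P (A ** B)"
      unfolding P_def
    proof (intro impI ballI)
      fix F :: "real^'d \<Rightarrow> ennreal"
      assume "det (A ** B) \<noteq> 0" and F[measurable]: "F \<in> borel_measurable borel"
      then have det: "det A \<noteq> 0" "det B \<noteq> 0" by (auto simp: det_mul)
      have "(\<integral>\<^sup>+y. F y \<partial>lborel) = ennreal \<bar>det A\<bar> * (\<integral>\<^sup>+z. F (A *v z) \<partial>lborel)"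
        using AB(1) det F unfolding P_def by blast
      also have "(\<lambda>z. F (A *v z)) \<in> borel_measurable borel" by measurable
      then have "(\<integral>\<^sup>+z. F (A *v z) \<partial>lborel) = ennreal \<bar>det B\<bar> * (\<integral>\<^sup>+z. F (A *v (B *v z)) \<partial>lborel)"
        using AB(2) det unfolding P_def by blast
      finally show "(\<integral>\<^sup>+y. F y \<partial>lborel) = ennreal \<bar>det (A ** B)\<bar> * (\<integral>\<^sup>+z. F (A ** B *v z) \<partial>lborel)"
        by (simp add: det_mul abs_mult ennreal_mult matrix_vector_mul_assoc mult.assoc)
    qed
  next
    show "P A" if "row i A = 0" for A i
      using that det_zero_row(1) unfolding P_def by blast
    show "P A" if "\<And>i j. i \<noteq> j \<Longrightarrow> A $ i $ j = 0" for A
      using that nn_integral_lborel_diagonal unfolding P_def by blast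
  next
    fix m n :: 'd
    let ?p = "Transposition.transpose m n"
    have p: "?p permutes (UNIV :: 'd set)" by (simp add: permutes_swap_id)
    have 1: "\<bar>det (\<chi> i j. mat 1 $ i $ ?p j :: real^'d^'d)\<bar> = 1"
      by (simp add: det_permute_columns[OF p] sign_swap_id)
    have 2: "(\<chi> i j. mat 1 $ i $ ?p j) *v z = (\<chi> i. z $ ?p i)" for z :: "real^'d"
    proof -
      have "((\<chi> i j. mat 1 $ i $ ?p j) *v z) $ i = (\<Sum>j\<in>UNIV. if j = ?p i then z $ j else 0)" for i
      proof -
        have "mat 1 $ i $ ?p j * z $ j = (if i = ?p j then z $ j else 0)" for j
          by (simp add: mat_def)
        also have "(if i = ?p j then z $ j else 0) = (if j = ?p i then z $ j else 0)" for j
          by (metis transpose_involutory)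
        finally show ?thesis
          unfolding matrix_vector_mult_def vec_lambda_beta by (intro sum.cong refl)
      qed
      then show ?thesis by (simp add: vec_eq_iff)
    qed
    show "P (\<chi> i j. mat 1 $ i $ ?p j)"
      unfolding P_def
    proof (intro impI ballI)
      fix F :: "real^'d \<Rightarrow> ennreal" assume "F \<in> borel_measurable borel"
      from nn_integral_lborel_permute[OF p this]
      show "(\<integral>\<^sup>+y. F y \<partial>lborel) = ennreal \<bar>det (\<chi> i j. mat 1 $ i $ ?p j :: real^'d^'d)\<bar>
        * (\<integral>\<^sup>+z. F ((\<chi> i j. mat 1 $ i $ ?p j) *v z) \<partial>lborel)"
        by (simp only: 1 2 ennreal_1 mult_1)
    qed
  next
    fix m n :: 'd assume mn: "m \<noteq> n"
    let ?A = "(\<chi> i j. of_bool (i = m \<and> j = n \<or> i = j)) :: real^'d^'d"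
    have "?A = (\<chi> k. if k = m then row m (mat 1) + 1 *s row n (mat 1) else row k (mat 1))"
      using mn by (auto simp: vec_eq_iff row_def mat_def)
    then have 1: "det ?A = 1"
      using det_row_operation[OF mn, of "mat 1" 1] by simp
    have 2: "?A *v z = z + (z $ n) *\<^sub>R axis m 1" for z
    proof -
      have "(?A *v z) $ i = z $ i + (if i = m then z $ n else 0)" for i
      proof -
        have "(?A *v z) $ i = (\<Sum>j\<in>UNIV. (if j = i then z $ j else 0) + (if j = n \<and> i = m then z $ j else 0))"
          using mn by (auto simp: matrix_vector_mult_def intro!: sum.cong)
        also have "\<dots> = z $ i + (if i = m then z $ n else 0)"
          by (simp add: sum.distrib)
        finally show ?thesis .
      qed
      then show ?thesis by (simp add: vec_eq_iff axis_def)
    qed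
    show "P ?A"
      unfolding P_def
    proof (intro impI ballI)
      fix F :: "real^'d \<Rightarrow> ennreal" assume "F \<in> borel_measurable borel"
      from nn_integral_lborel_shear[OF mn this]
      show "(\<integral>\<^sup>+y. F y \<partial>lborel) = ennreal \<bar>det ?A\<bar> * (\<integral>\<^sup>+z. F (?A *v z) \<partial>lborel)"
        by (simp only: 1 2 abs_one ennreal_1 mult_1)
    qed
  qed
  then show ?thesis using assms unfolding P_def by blast
qed

section \<open>Quadratic forms and Gaussian integrals\<close>

definition quad :: "real^'d^'d \<Rightarrow> real^'d \<Rightarrow> real"
  where "quad A v = v \<bullet> (A *v v)"

lemma quad_bounded: "\<exists>C\<ge>0. \<forall>y. \<bar>quad A y\<bar> \<le> C * (norm y)\<^sup>2" for A :: "real^'d^'d"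
proof -
  obtain C where C: "\<And>y. norm (A *v y) \<le> norm y * C"
    using bounded_linear.bounded[OF matrix_vector_mul_bounded_linear[of A]] by blast
  have "\<bar>quad A y\<bar> \<le> \<bar>C\<bar> * (norm y)\<^sup>2" for y
  proof -
    have "\<bar>quad A y\<bar> \<le> norm y * norm (A *v y)" unfolding quad_def by (rule Cauchy_Schwarz_ineq2)
    also have "\<dots> \<le> norm y * (norm y * \<bar>C\<bar>)"
      by (intro mult_left_mono order_trans[OF C] mult_left_mono) auto
    finally show ?thesis by (simp add: power2_eq_square mult_ac)
  qed
  then show ?thesis by (intro exI[of _ "\<bar>C\<bar>"]) auto
qed

lemma inner_mult_self: "(A *v v) \<bullet> v = quad A v"
  by (simp add: quad_def inner_commute)

lemma symmetric_matrix_inner: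
  "symmetric_matrix A \<Longrightarrow> v \<bullet> (A *v w) = w \<bullet> (A *v v)"
  by (metis dot_lmul_matrix inner_commute symmetric_matrix_def transpose_matrix_vector)

lemma quad_add:
  assumes "symmetric_matrix A"
  shows "quad A (v + w) = quad A v + 2 * (v \<bullet> (A *v w)) + quad A w"
  using symmetric_matrix_inner[OF assms, of v w]
  by (simp add: quad_def matrix_vector_right_distrib inner_add_left inner_add_right)

lemma quad_scaleR: "quad A (r *\<^sub>R v) = r\<^sup>2 * quad A v"
  by (simp add: quad_def matrix_vector_mult_scaleR power2_eq_square)

lemma quad_minus [simp]: "quad A (- v) = quad A v"
  using quad_scaleR[of A "-1" v] by simp

lemma quad_zero [simp]: "quad A 0 = 0"
  by (simp add: quad_def)

lemma quad_diff:
  assumes "symmetric_matrix A"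
  shows "quad A (v - w) = quad A v - 2 * (v \<bullet> (A *v w)) + quad A w"
  using quad_add[OF assms, of v "- w"] matrix_vector_mult_scaleR[of A "-1" w] by simp

lemma continuous_on_quad: "continuous_on UNIV (quad A)"
  unfolding quad_def
  by (intro continuous_on_inner continuous_on_id linear_continuous_on matrix_vector_mul_bounded_linear)

lemma borel_measurable_quad [measurable]: "quad A \<in> borel_measurable borel"
  by (intro borel_measurable_continuous_onI continuous_on_quad)

lemma sym_pos_def_symmetric: "sym_pos_def A \<Longrightarrow> symmetric_matrix A"
  by (simp add: sym_pos_def_def)

lemma quad_pos: "sym_pos_def A \<Longrightarrow> v \<noteq> 0 \<Longrightarrow> 0 < quad A v"
  by (simp add: sym_pos_def_def quad_def)

lemma quad_nonneg: "sym_pos_def A \<Longrightarrow> 0 \<le> quad A v"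
  using quad_pos[of A v] by (cases "v = 0") auto

lemma quad_cauchy_schwarz:
  assumes "sym_pos_def A"
  shows "(v \<bullet> (A *v w))\<^sup>2 \<le> quad A v * quad A w"
proof (cases "w = 0")
  case False
  note sym = sym_pos_def_symmetric[OF assms]
  define r where "r = (v \<bullet> (A *v w)) / quad A w"
  have p: "0 < quad A w" using quad_pos assms False by blast
  have "0 \<le> quad A (v - r *\<^sub>R w)" by (rule quad_nonneg[OF assms])
  also have "\<dots> = quad A v - 2 * r * (v \<bullet> (A *v w)) + r\<^sup>2 * quad A w"
    by (simp add: quad_diff[OF sym] quad_scaleR matrix_vector_mult_scaleR)
  also have "\<dots> = quad A v - (v \<bullet> (A *v w))\<^sup>2 / quad A w"
    using p by (simp add: r_def power2_eq_square field_simps)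
  finally show ?thesis using p by (simp add: field_simps)
qed simp

text \<open>Gram-Schmidt with respect to the inner product \<open>v \<bullet> A w\<close>.\<close>

lemma ex_orthonormal_family:
  fixes A :: "real^'d^'d"
  assumes A: "sym_pos_def A" and "k \<le> CARD('d)"
  shows "\<exists>f :: nat \<Rightarrow> real^'d. \<forall>i<k. \<forall>j<k. f i \<bullet> (A *v f j) = of_bool (i = j)"
  using assms(2)
proof (induction k)
  case (Suc k)
  note sym = sym_pos_def_symmetric[OF A]
  obtain f :: "nat \<Rightarrow> real^'d" where f: "\<And>i j. i < k \<Longrightarrow> j < k \<Longrightarrow> f i \<bullet> (A *v f j) = of_bool (i = j)"
    using Suc by auto
  have "dim (f ` {..<k}) \<le> card (f ` {..<k})"
    by (intro dim_le_card') auto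
  also have "\<dots> \<le> k" using card_image_le[of "{..<k}" f] by simp
  finally have "dim (span (f ` {..<k})) < CARD('d)" using Suc by simp
  then have "span (f ` {..<k}) \<noteq> UNIV" by (metis dim_UNIV less_irrefl dim_span DIM_cart DIM_real mult.right_neutral)
  then obtain x where x: "x \<notin> span (f ` {..<k})" by auto
  define y where "y = x - (\<Sum>i<k. (x \<bullet> (A *v f i)) *\<^sub>R f i)"
  have "(\<Sum>i<k. (x \<bullet> (A *v f i)) *\<^sub>R f i) \<in> span (f ` {..<k})"
    by (intro span_sum span_scale span_base) auto
  then have "y \<noteq> 0" using x by (auto simp: y_def)
  have yf: "y \<bullet> (A *v f j) = 0" if "j < k" for j
  proof -
    have "(\<Sum>i<k. (x \<bullet> (A *v f i)) * (f i \<bullet> (A *v f j))) = (\<Sum>i<k. if i = j then x \<bullet> (A *v f i) else 0)"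
      using f that by (intro sum.cong) auto
    then show ?thesis using that by (simp add: y_def inner_diff_left inner_sum_left)
  qed
  define z where "z = (1 / sqrt (quad A y)) *\<^sub>R y"
  have q: "0 < quad A y" using quad_pos A \<open>y \<noteq> 0\<close> by blast
  have zz: "z \<bullet> (A *v z) = 1"
    using q by (simp add: z_def quad_scaleR power_divide flip: quad_def)
  have zf: "z \<bullet> (A *v f j) = 0" "f j \<bullet> (A *v z) = 0" if "j < k" for j
    using yf[OF that] symmetric_matrix_inner[OF sym, of z "f j"] by (simp_all add: z_def)
  have "\<forall>i<Suc k. \<forall>j<Suc k. (f(k := z)) i \<bullet> (A *v (f(k := z)) j) = of_bool (i = j)"
    using f zz zf by (auto simp: less_Suc_eq)
  then show ?case by blast
qed simp

lemma inner_transpose_mult: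
  fixes T :: "real^'n^'m"
  shows "z \<bullet> (transpose T *v w) = (T *v z) \<bullet> w"
  by (metis dot_lmul_matrix inner_commute transpose_matrix_vector)

text \<open>The columns of T are an \<open>A\<close>-orthonormal family of full length. The
  substitution y = T z turns \<open>quad A\<close> into the squared norm, and taking determinants of
  the identity gives the Jacobian.\<close>

lemma ex_congruent_identity:
  fixes A :: "real^'d^'d"
  assumes A: "sym_pos_def A"
  obtains T :: "real^'d^'d" where "transpose T ** A ** T = mat 1"
proof -
  obtain f :: "nat \<Rightarrow> real^'d"
    where f: "\<And>i j. i < CARD('d) \<Longrightarrow> j < CARD('d) \<Longrightarrow> f i \<bullet> (A *v f j) = of_bool (i = j)"
    using ex_orthonormal_family[OF A order_refl] by blast
  obtain h :: "'d \<Rightarrow> nat" where h: "bij_betw h UNIV {0..<CARD('d)}"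
    using ex_bij_betw_finite_nat[of "UNIV :: 'd set"] by auto
  have hl: "h i < CARD('d)" for i using bij_betwE[OF h] by auto
  have hi: "h i = h j \<longleftrightarrow> i = j" for i j using bij_betw_imp_inj_on[OF h] by (auto dest: injD)
  define T :: "real^'d^'d" where "T = (\<chi> i j. f (h j) $ i)"
  have Tx: "T *v axis i 1 = f (h i)" for i
    by (simp add: T_def vec_eq_iff matrix_vector_mult_def axis_def if_distrib cong: if_cong)
  have "(transpose T ** A ** T) $ i $ j = mat 1 $ i $ j" for i j
  proof -
    have "(transpose T ** A ** T) $ i $ j = axis i 1 \<bullet> ((transpose T ** A ** T) *v axis j 1)"
      by (simp add: inner_axis' matrix_vector_mult_basis column_def)
    also have "\<dots> = (T *v axis i 1) \<bullet> (A *v (T *v axis j 1))"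
      by (simp only: matrix_vector_mul_assoc[symmetric] inner_transpose_mult)
    also have "\<dots> = mat 1 $ i $ j"
      by (simp add: Tx f hl hi mat_def)
    finally show ?thesis .
  qed
  then have "transpose T ** A ** T = mat 1" by (simp add: vec_eq_iff)
  then show thesis by (rule that)
qed

lemma quad_congruent:
  assumes "transpose T ** A ** T = mat 1"
  shows "quad A (T *v z) = z \<bullet> z"
proof -
  have "quad A (T *v z) = z \<bullet> ((transpose T ** A ** T) *v z)"
    by (simp only: quad_def matrix_vector_mul_assoc[symmetric] inner_transpose_mult)
  then show ?thesis by (simp add: assms)
qed

lemma det_congruent:
  fixes A :: "real^'d^'d"
  assumes "transpose T ** A ** T = mat 1"
  shows "(det T)\<^sup>2 * det A = 1"
  using arg_cong[OF assms, of det] by (simp add: det_mul power2_eq_square mult_ac)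

lemma det_pos:
  fixes A :: "real^'d^'d"
  assumes "sym_pos_def A"
  shows "0 < det A"
proof -
  obtain T :: "real^'d^'d" where "transpose T ** A ** T = mat 1" using ex_congruent_identity assms by blast
  then have "(det T)\<^sup>2 * det A = 1" by (rule det_congruent)
  then have "0 < (det T)\<^sup>2 * det A" by simp
  then show ?thesis by (simp add: zero_less_mult_iff)
qed

text \<open>Finiteness is all that matters here: the value of the integral cancels in
  \<open>gauss_integral_ratio\<close>.\<close>

lemma nn_integral_std_gaussian_finite:
  "(\<integral>\<^sup>+z. ennreal (exp (- (z \<bullet> (z::real^'d)) / 2)) \<partial>lborel) < \<infinity>"
proof -
  have "(\<integral>\<^sup>+x. ennreal (exp (- x\<^sup>2 / 2)) \<partial>lborel) < \<infinity>"
  proof -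
    have "integrable lborel (\<lambda>x. sqrt (2 * pi) * std_normal_density x)"
      by (intro integrable_mult_right integrable_normal_density) simp
    then have "integrable lborel (\<lambda>x::real. exp (- x\<^sup>2 / 2))"
      by (simp add: std_normal_density_def)
    then show ?thesis by (simp add: integrable_iff_bounded)
  qed
  moreover have "ennreal (exp (- (z \<bullet> z) / 2)) = (\<Prod>b\<in>Basis. ennreal (exp (- (z \<bullet> b)\<^sup>2 / 2)))" for z :: "real^'d"
    by (subst euclidean_inner) (simp add: prod_ennreal exp_sum[symmetric] power2_eq_square sum_negf sum_divide_distrib)
  ultimately show ?thesis
    using nn_integral_lborel_prod[where f = "\<lambda>_ x. ennreal (exp (- x\<^sup>2 / 2))" and 'a = "real^'d"]
    by (simp add: power_less_top_ennreal)
qed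

section \<open>Gaussian masses and integrability under Gaussian tails\<close>

definition gauss_integral :: "real^'d^'d \<Rightarrow> real"
  where "gauss_integral A = (\<integral>y. exp (- quad A y / 2) \<partial>lborel)"

lemma nn_integral_gauss:
  fixes A :: "real^'d^'d"
  assumes "sym_pos_def A"
  shows "(\<integral>\<^sup>+y. ennreal (exp (- quad A y / 2)) \<partial>lborel)
    = ennreal (1 / sqrt (det A)) * (\<integral>\<^sup>+z. ennreal (exp (- (z \<bullet> (z::real^'d)) / 2)) \<partial>lborel)"
proof -
  obtain T :: "real^'d^'d" where T: "transpose T ** A ** T = mat 1" using ex_congruent_identity assms by blast
  note d = det_congruent[OF T]
  then have nz: "det T \<noteq> 0" by auto
  have "\<bar>det T\<bar> = sqrt ((det T)\<^sup>2)" by simp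
  also have "(det T)\<^sup>2 = 1 / det A" using d det_pos[OF assms] by (simp add: field_simps)
  finally have "\<bar>det T\<bar> = 1 / sqrt (det A)" by (simp add: real_sqrt_divide)
  then show ?thesis
    using nn_integral_lborel_linear[OF nz, of "\<lambda>y. ennreal (exp (- quad A y / 2))"]
    by (simp add: quad_congruent[OF T])
qed

lemma integrable_gauss:
  fixes A :: "real^'d^'d"
  assumes "sym_pos_def A"
  shows "integrable lborel (\<lambda>y. exp (- quad A y / 2))"
proof (rule integrableI_bounded)
  show "(\<integral>\<^sup>+y. ennreal (norm (exp (- quad A y / 2))) \<partial>lborel) < \<infinity>"
    using nn_integral_std_gaussian_finite[where 'd = 'd]
    by (simp only: real_norm_def abs_exp_cancel nn_integral_gauss[OF assms]) (simp add: ennreal_mult_less_top)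
qed measurable

lemma integral_exp_pos:
  assumes "integrable lborel (\<lambda>y. exp (f (y :: real^'d)) :: real)"
  shows "0 < (\<integral>y. exp (f y) \<partial>lborel)"
proof -
  have "(\<integral>y. exp (f y) \<partial>lborel) \<noteq> 0"
    using integral_nonneg_eq_0_iff_AE[OF assms]
    by (auto simp: eventually_False ae_filter_eq_bot_iff)
  moreover have "0 \<le> (\<integral>y. exp (f y) \<partial>lborel)" by (intro integral_nonneg_AE) simp
  ultimately show ?thesis by (metis less_le)
qed

lemma gauss_integral_pos: "sym_pos_def A \<Longrightarrow> 0 < gauss_integral A"
  unfolding gauss_integral_def by (rule integral_exp_pos[OF integrable_gauss])

text \<open>Turns the determinant expression for c in the theorem into a ratio of Gaussian masses,
  the form in which it can be compared with the mass of exp (-u).\<close>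

lemma gauss_integral_ratio:
  fixes A B :: "real^'d^'d"
  assumes A: "sym_pos_def A" and B: "sym_pos_def B"
  shows "gauss_integral B = sqrt (det A / det B) * gauss_integral A"
proof -
  define c where "c = enn2real (\<integral>\<^sup>+z. ennreal (exp (- (z \<bullet> (z::real^'d)) / 2)) \<partial>lborel)"
  have g: "gauss_integral A = 1 / sqrt (det A) * c" if A: "sym_pos_def A" for A :: "real^'d^'d"
    unfolding gauss_integral_def c_def
    by (subst integral_eq_nn_integral)
      (simp_all only: nn_integral_gauss[OF A] enn2real_mult integrable_gauss[OF A] exp_ge_zero
        enn2real_ennreal less_imp_le[OF det_pos[OF A]] AE_I2 zero_le_divide_iff real_sqrt_ge_zero zero_le_one simp_thms borel_measurable_integrable)
  show ?thesis
    using det_pos[OF A] det_pos[OF B] by (simp add: g A B real_sqrt_divide field_simps)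
qed

lemma sym_pos_def_scaleR:
  assumes "sym_pos_def A" "0 < r"
  shows "sym_pos_def (r *\<^sub>R A)"
proof -
  have "transpose (r *\<^sub>R A) = r *\<^sub>R A"
    using assms by (simp add: sym_pos_def_def symmetric_matrix_def transpose_scalar)
  then show ?thesis
    using assms by (simp add: sym_pos_def_def symmetric_matrix_def scaleR_matrix_vector_assoc[symmetric])
qed

text \<open>Half of the Gaussian exponent absorbs the exponential growth: in coordinates where
  \<open>quad A\<close> is the squared norm of z, b * norm y is at most (b \<kappa>)^2 plus a
  quarter of that squared norm. The other half still gives an integrable Gaussian, that of
  \<open>(1/2) *\<^sub>R A\<close>.\<close>

lemma integrable_exp_norm_gauss:
  fixes F :: "real^'d \<Rightarrow> real"
  assumes A: "sym_pos_def A" and [measurable]: "F \<in> borel_measurable borel"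
    and F: "\<And>y. \<bar>F y\<bar> \<le> C * exp (b * norm y - quad A y / 2)"
  shows "integrable lborel F"
proof -
  obtain T :: "real^'d^'d" where T: "transpose T ** A ** T = mat 1" using ex_congruent_identity A by blast
  obtain \<kappa> where \<kappa>: "\<And>z. norm (T *v z) \<le> norm z * \<kappa>"
    using bounded_linear.bounded[OF matrix_vector_mul_bounded_linear[of T]] by blast
  have "det T \<noteq> 0" using det_congruent[OF T] by auto
  then have "invertible T" by (simp add: invertible_det_nz)
  then have surj: "\<exists>z. y = T *v z" for y
    by (metis invertible_def matrix_vector_mul_assoc matrix_vector_mul_lid)
  have "0 \<le> C * exp (b * norm (0 :: real^'d) - quad A 0 / 2)"
    by (rule order_trans[OF abs_ge_zero F])
  then have "C \<ge> 0" by simp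
  have "b * norm y - quad A y / 2 \<le> (b * \<kappa>)\<^sup>2 - quad ((1/2) *\<^sub>R A) y / 2" for y
  proof -
    obtain z where z: "y = T *v z" using surj by blast
    have q: "quad A y = (norm z)\<^sup>2" by (simp add: z quad_congruent[OF T] power2_norm_eq_inner)
    have "norm y \<le> norm z * \<bar>\<kappa>\<bar>"
      unfolding z by (rule order_trans[OF \<kappa> mult_left_mono[OF abs_ge_self norm_ge_zero]])
    then have "b * norm y \<le> \<bar>b\<bar> * (norm z * \<bar>\<kappa>\<bar>)"
      by (intro mult_mono) auto
    moreover
    have "0 \<le> (\<bar>b\<bar> * \<bar>\<kappa>\<bar> - norm z / 2)\<^sup>2" by simp
    then have "\<bar>b\<bar> * (norm z * \<bar>\<kappa>\<bar>) \<le> (b * \<kappa>)\<^sup>2 + (norm z)\<^sup>2 / 4"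
      by (simp add: power2_eq_square algebra_simps)
    ultimately show ?thesis
      using q by (simp add: quad_def scaleR_matrix_vector_assoc[symmetric])
  qed
  then have "C * exp (b * norm y - quad A y / 2) \<le> (C * exp ((b * \<kappa>)\<^sup>2)) * exp (- quad ((1/2) *\<^sub>R A) y / 2)" for y
    using \<open>C \<ge> 0\<close> by (simp add: mult_left_mono mult.assoc flip: exp_add)
  then have le: "\<bar>F y\<bar> \<le> (C * exp ((b * \<kappa>)\<^sup>2)) * exp (- quad ((1/2) *\<^sub>R A) y / 2)" for y
    using F order_trans by blast
  have "integrable lborel (\<lambda>y. (C * exp ((b * \<kappa>)\<^sup>2)) * exp (- quad ((1/2) *\<^sub>R A) y / 2))"
    by (intro integrable_mult_right integrable_gauss sym_pos_def_scaleR A) simp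
  then show ?thesis
    by (rule Bochner_Integration.integrable_bound) (use le \<open>C \<ge> 0\<close> in \<open>auto simp: abs_mult\<close>)
qed

section \<open>Measures between two Gaussians\<close>

text \<open>The derivative of the exponential at 0, taken from the right. Both variance bounds reach
  their infinitesimal limit through it; \<tau> is then, up to a constant factor, the squared size of
  the translation or of the tilt.\<close>

lemma le_of_mult_le_exp_minus_one:
  fixes a X :: real
  assumes "\<And>\<tau>. 0 < \<tau> \<Longrightarrow> X * \<tau> \<le> exp (a * \<tau>) - 1"
  shows "X \<le> a"
proof (rule tendsto_lowerbound)
  have "((\<lambda>\<tau>. exp (a * \<tau>)) has_field_derivative a) (at 0)"
    by (auto intro!: derivative_eq_intros)
  then have "((\<lambda>\<tau>. (exp (a * \<tau>) - 1) / \<tau>) \<longlongrightarrow> a) (at 0)"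
    by (simp add: has_field_derivative_iff)
  then show "((\<lambda>\<tau>. (exp (a * \<tau>) - 1) / \<tau>) \<longlongrightarrow> a) (at_right 0)"
    by (rule tendsto_mono[rotated]) (simp add: at_le)
  show "\<forall>\<^sub>F \<tau> in at_right 0. X \<le> (exp (a * \<tau>) - 1) / \<tau>"
    using assms by (auto simp: eventually_at_right_field field_simps intro!: exI[of _ 1])
qed simp

text \<open>The right side is (2 sinh (x/2))^2, so the difference factors, and both factors have the
  sign of x. It extracts a second moment from exponential moments pointwise, with no expansion under
  the integral.\<close>

lemma exp_sum_ge: "x\<^sup>2 \<le> exp x + exp (- x) - (2 :: real)"
proof -
  have "0 \<le> (exp (x/2) - exp (- x/2) - x) * (exp (x/2) - exp (- x/2) + x)"
  proof -
    have aux: "2 * y \<le> exp y - exp (- y)" if "0 \<le> y" for y :: real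
    proof -
      have "(\<lambda>y. exp y - exp (- y) - 2 * y) 0 \<le> (\<lambda>y. exp y - exp (- y) - 2 * y) y"
      proof (rule DERIV_nonneg_imp_nondecreasing[OF that])
        fix t :: real
        have "0 \<le> (exp (t/2) - exp (- t/2))\<^sup>2" by simp
        also have "\<dots> = exp t + exp (- t) - 2"
          by (simp add: power2_eq_square algebra_simps flip: exp_add)
        finally show "\<exists>y. ((\<lambda>y. exp y - exp (- y) - 2 * y) has_real_derivative y) (at t) \<and> 0 \<le> y"
          by (intro exI[of _ "exp t + exp (- t) - 2"]) (auto intro!: derivative_eq_intros)
      qed
      then show ?thesis by simp
    qed
    show ?thesis
    proof (cases "0 \<le> x")
      case True
      have "x \<le> exp (x/2) - exp (- x/2)" using aux[of "x/2"] True by simp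
      then show ?thesis using True by (intro mult_nonneg_nonneg) auto
    next
      case False
      have "- x \<le> exp (- x/2) - exp (x/2)" using aux[of "- x/2"] False by simp
      then show ?thesis using False by (intro mult_nonpos_nonpos) auto
    qed
  qed
  also have "\<dots> = exp x + exp (- x) - 2 - x\<^sup>2"
    by (simp add: power2_eq_square algebra_simps flip: exp_add)
  finally show ?thesis by simp
qed

lemma square_le_mult_of_quadratic_nonneg:
  fixes A B p :: real
  assumes "\<And>r. 0 \<le> A - 2 * r * B + r\<^sup>2 * p" "0 \<le> p"
  shows "B\<^sup>2 \<le> A * p"
proof (cases "p = 0")
  case True
  have "B = 0"
  proof (rule ccontr)
    assume "B \<noteq> 0"
    then show False using assms(1)[of "(A + 1) / (2 * B)"] True by simp
  qed
  then show ?thesis using True by simp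
next
  case False
  then show ?thesis
    using assms(1)[of "B / p"] assms(2) by (simp add: field_simps power2_eq_square)
qed

lemma weighted_cauchy_schwarz:
  fixes \<omega> q :: "'a \<Rightarrow> real"
  assumes "\<And>y. 0 \<le> \<omega> y"
    and [simp]: "integrable M \<omega>" "integrable M (\<lambda>y. q y * \<omega> y)" "integrable M (\<lambda>y. (q y)\<^sup>2 * \<omega> y)"
  shows "(\<integral>y. q y * \<omega> y \<partial>M)\<^sup>2 \<le> (\<integral>y. (q y)\<^sup>2 * \<omega> y \<partial>M) * (\<integral>y. \<omega> y \<partial>M)"
proof (rule square_le_mult_of_quadratic_nonneg)
  fix r
  have "0 \<le> (\<integral>y. (q y - r)\<^sup>2 * \<omega> y \<partial>M)"
    using assms(1) by (intro integral_nonneg_AE) simp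
  also have "(\<lambda>y. (q y - r)\<^sup>2 * \<omega> y) = (\<lambda>y. (q y)\<^sup>2 * \<omega> y - 2 * r * (q y * \<omega> y) + r\<^sup>2 * \<omega> y)"
    by (auto simp: power2_eq_square algebra_simps)
  also have "(\<integral>y. \<dots> y \<partial>M) = (\<integral>y. (q y)\<^sup>2 * \<omega> y \<partial>M) - 2 * r * (\<integral>y. q y * \<omega> y \<partial>M) + r\<^sup>2 * (\<integral>y. \<omega> y \<partial>M)"
    by simp
  finally show "0 \<le> (\<integral>y. (q y)\<^sup>2 * \<omega> y \<partial>M) - 2 * r * (\<integral>y. q y * \<omega> y \<partial>M) + r\<^sup>2 * (\<integral>y. \<omega> y \<partial>M)" .
qed (use assms(1) in \<open>auto intro: integral_nonneg_AE\<close>)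

lemma integrable_lborel_translate:
  fixes F :: "real^'d \<Rightarrow> real"
  assumes [measurable]: "F \<in> borel_measurable borel"
  shows "integrable lborel (\<lambda>y. F (h + y)) \<longleftrightarrow> integrable lborel F"
    and "(\<integral>y. F (h + y) \<partial>lborel) = (\<integral>y. F y \<partial>lborel)"
proof -
  have d: "(lborel :: (real^'d) measure) = distr lborel borel ((+) h)" by (rule lborel_distr_plus[symmetric])
  show "integrable lborel (\<lambda>y. F (h + y)) \<longleftrightarrow> integrable lborel F"
    by (subst (2) d) (simp add: integrable_distr_eq)
  show "(\<integral>y. F (h + y) \<partial>lborel) = (\<integral>y. F y \<partial>lborel)"
    by (subst (2) d) (simp add: integral_distr)
qed

lemma norm_le_exp: "norm y \<le> exp (norm (y :: real^'d))"
  using exp_ge_add_one_self[of "norm y"] by linarith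

text \<open>\<open>u\<close> is the potential recentred at its minimum and \<open>g\<close> plays
  the role of its gradient. Stating the Hessian bounds as increments of \<open>u\<close> keeps
  derivatives out of the probabilistic arguments, and purely quadratic potentials are instances with
  \<open>Am\<close> equal to \<open>Ap\<close>.\<close>

locale sandwiched_potential =
  fixes u :: "real^'d \<Rightarrow> real" and g :: "real^'d \<Rightarrow> real^'d" and Am Ap :: "real^'d^'d"
  assumes Am: "sym_pos_def Am" and Ap: "sym_pos_def Ap"
    and u_measurable [measurable]: "u \<in> borel_measurable borel"
    and u_zero: "u 0 = 0" and g_zero: "g 0 = 0"
    and u_lower: "\<And>y h. u y + g y \<bullet> h + quad Am h / 2 \<le> u (y + h)"
    and u_upper: "\<And>y h. u (y + h) \<le> u y + g y \<bullet> h + quad Ap h / 2"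
begin

lemma u_bounds: "quad Am y / 2 \<le> u y" "u y \<le> quad Ap y / 2"
  using u_lower[of 0 y] u_upper[of 0 y] by (simp_all add: u_zero g_zero)

lemma quad_Am_le_Ap: "quad Am y \<le> quad Ap y"
  using u_bounds[of y] by linarith

lemma integrable_exp_u: "integrable lborel (\<lambda>y. exp (- u y))"
  by (rule integrable_exp_norm_gauss[OF Am, of _ 1 0]) (use u_bounds(1) in auto)

definition K where "K = (\<integral>y. exp (- u y) \<partial>lborel)"

lemma K_pos: "0 < K"
  unfolding K_def by (rule integral_exp_pos[OF integrable_exp_u])

definition N where "N = density lborel (\<lambda>y. ennreal (exp (- u y) / K))"

lemma sets_N [measurable_cong, simp]: "sets N = sets borel" and space_N [simp]: "space N = UNIV"
  by (simp_all add: N_def)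

lemma integrable_N:
  assumes [measurable]: "F \<in> borel_measurable borel"
  shows "integrable N F \<longleftrightarrow> integrable lborel (\<lambda>y. F y * exp (- u y))"
proof -
  have "integrable N F \<longleftrightarrow> integrable lborel (\<lambda>y. (1 / K) * (F y * exp (- u y)))"
    unfolding N_def using K_pos by (subst integrable_density) (auto simp: mult.commute)
  also have "\<dots> \<longleftrightarrow> integrable lborel (\<lambda>y. F y * exp (- u y))"
    using K_pos integrable_mult_right_iff[of lborel "\<lambda>y. F y * exp (- u y)" "1 / K"] by simp
  finally show ?thesis .
qed

lemma integral_N:
  assumes [measurable]: "F \<in> borel_measurable borel"
  shows "(\<integral>y. F y \<partial>N) = (\<integral>y. F y * exp (- u y) \<partial>lborel) / K"
  unfolding N_def using K_pos by (subst integral_density) (auto simp: mult.commute)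

lemma integrable_N_exp:
  assumes [measurable]: "F \<in> borel_measurable borel" and F: "\<And>y. \<bar>F y\<bar> \<le> C * exp (b * norm y)"
  shows "integrable N F"
proof (subst integrable_N, measurable, rule integrable_exp_norm_gauss[OF Am])
  fix y :: "real^'d"
  have "0 \<le> C * exp (b * norm y)" by (rule order_trans[OF abs_ge_zero F])
  have "\<bar>F y * exp (- u y)\<bar> = \<bar>F y\<bar> * exp (- u y)" by (simp add: abs_mult)
  also have "\<dots> \<le> (C * exp (b * norm y)) * exp (- quad Am y / 2)"
    using F u_bounds(1)[of y] \<open>0 \<le> C * exp (b * norm y)\<close> by (intro mult_mono) auto
  also have "\<dots> = C * exp (b * norm y - quad Am y / 2)"
    by (simp add: mult.assoc flip: exp_add)
  finally show "\<bar>F y * exp (- u y)\<bar> \<le> C * exp (b * norm y - quad Am y / 2)" .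
qed measurable

sublocale prob_space N
proof
  have "emeasure N UNIV = (\<integral>\<^sup>+y. ennreal (exp (- u y) / K) \<partial>lborel)"
    by (simp add: N_def emeasure_density)
  also have "\<dots> = ennreal (\<integral>y. exp (- u y) / K \<partial>lborel)"
    using K_pos by (intro nn_integral_eq_integral) (auto intro: integrable_exp_u)
  also have "\<dots> = 1" using K_pos by (simp flip: K_def)
  finally show "emeasure N (space N) = 1" by simp
qed

lemma integrable_norm: "integrable N (\<lambda>y. norm y)"
  by (rule integrable_N_exp[of _ 1 1]) (use norm_le_exp in auto)

lemma integrable_id: "integrable N (\<lambda>y. y)"
  by (rule Bochner_Integration.integrable_bound[OF integrable_norm]) auto

lemma integrable_inner [simp]: "integrable N (\<lambda>y. w \<bullet> y)"
  using integrable_id by (rule integrable_inner_right)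

lemma integrable_norm_square: "integrable N (\<lambda>y. (norm y)\<^sup>2)"
proof (rule integrable_N_exp[of _ 1 2])
  fix y :: "real^'d"
  have "(norm y)\<^sup>2 \<le> (exp (norm y))\<^sup>2" using norm_le_exp by (intro power_mono) auto
  then show "\<bar>(norm y)\<^sup>2\<bar> \<le> 1 * exp (2 * norm y)"
    by (simp add: exp_double)
qed measurable

lemma integrable_inner_mult [simp]: "integrable N (\<lambda>y. (v \<bullet> y) * (w \<bullet> y))"
proof (rule Bochner_Integration.integrable_bound)
  show "integrable N (\<lambda>y. norm v * norm w * (norm y)\<^sup>2)"
    by (intro integrable_mult_right integrable_norm_square)
  have "\<bar>v \<bullet> y\<bar> * \<bar>w \<bullet> y\<bar> \<le> (norm v * norm y) * (norm w * norm y)" for y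
    by (intro mult_mono Cauchy_Schwarz_ineq2) auto
  then show "AE y in N. norm ((v \<bullet> y) * (w \<bullet> y)) \<le> norm (norm v * norm w * (norm y)\<^sup>2)"
    by (simp add: abs_mult power2_eq_square mult_ac)
qed measurable

lemma integrable_inner_square [simp]: "integrable N (\<lambda>y. (w \<bullet> y)\<^sup>2)"
  using integrable_inner_mult[of w w] by (simp add: power2_eq_square)

lemma integrable_exp_inner: "integrable N (\<lambda>y. exp (w \<bullet> y))"
proof (rule integrable_N_exp[of _ 1 "norm w"])
  show "\<bar>exp (w \<bullet> y)\<bar> \<le> 1 * exp (norm w * norm y)" for y
    using norm_cauchy_schwarz[of w y] by simp
qed measurable

lemma integrable_quad [simp]: "integrable N (quad A)"
proof -
  obtain C where C: "C \<ge> 0" "\<And>y. \<bar>quad A y\<bar> \<le> C * (norm y)\<^sup>2" using quad_bounded by blast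
  show ?thesis
  proof (rule Bochner_Integration.integrable_bound)
    show "integrable N (\<lambda>y. C * (norm y)\<^sup>2)" by (intro integrable_mult_right integrable_norm_square)
  qed (use C in auto)
qed

lemma integrable_quad_translate:
  assumes "symmetric_matrix A"
  shows "integrable N (\<lambda>y. quad A (y + h))"
proof -
  have "(\<lambda>y. quad A (y + h)) = (\<lambda>y. quad A y + 2 * ((A *v h) \<bullet> y) + quad A h)"
    by (simp add: quad_add[OF assms] inner_commute)
  then show ?thesis by simp
qed

lemma integrable_u_translate: "integrable N (\<lambda>y. u (y + h))"
proof (rule Bochner_Integration.integrable_bound[OF integrable_quad_translate[OF sym_pos_def_symmetric[OF Ap], of h]])
  have "0 \<le> u y" for y using u_bounds(1)[of y] quad_nonneg[OF Am, of y] by linarith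
  moreover have "u y \<le> quad Ap y" for y using u_bounds(2)[of y] quad_nonneg[OF Ap, of y] by linarith
  ultimately show "AE y in N. norm (u (y + h)) \<le> norm (quad Ap (y + h))"
    by (auto intro!: AE_I2 order_trans[OF _ abs_ge_self])
qed measurable

lemma integrable_u [simp]: "integrable N u"
  using integrable_u_translate[of 0] by simp

end

section \<open>Translations, tilts and the two variance bounds\<close>

context sandwiched_potential
begin

lemma prob_UNIV [simp]: "prob UNIV = 1"
  using prob_space by simp

text \<open>\<open>exp (u y - u (y + h))\<close> is the likelihood ratio, relative to
  \<open>N\<close>, of \<open>N\<close> translated by -h; this is a change of variables under
  Lebesgue measure.\<close>

lemma translate_N:
  assumes [measurable]: "F \<in> borel_measurable borel" and int: "integrable N (\<lambda>y. F (y - h))"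
  shows "integrable N (\<lambda>y. F y * exp (u y - u (y + h)))"
    and "(\<integral>y. F y * exp (u y - u (y + h)) \<partial>N) = (\<integral>y. F (y - h) \<partial>N)"
proof -
  define G where "G y = F (y - h) * exp (- u y)" for y
  have [measurable]: "G \<in> borel_measurable borel" unfolding G_def by measurable
  have eq: "F y * exp (u y - u (y + h)) * exp (- u y) = G (h + y)" for y
    by (simp add: G_def mult.assoc add.commute flip: exp_add)
  have "integrable lborel G"
    using int unfolding G_def by (subst (asm) integrable_N) auto
  then show "integrable N (\<lambda>y. F y * exp (u y - u (y + h)))"
    by (subst integrable_N) (simp_all add: eq integrable_lborel_translate)
  show "(\<integral>y. F y * exp (u y - u (y + h)) \<partial>N) = (\<integral>y. F (y - h) \<partial>N)"
    by (simp add: integral_N eq integrable_lborel_translate flip: G_def)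
qed

lemma likelihood_ratio:
  "integrable N (\<lambda>y. exp (u y - u (y + h)))" "(\<integral>y. exp (u y - u (y + h)) \<partial>N) = 1"
  using translate_N[of "\<lambda>_. 1" h] by (simp_all add: prob_space)

text \<open>The difference of the two sides is the relative entropy of \<open>N\<close> with respect
  to its translate, which is nonnegative. Hence h = 0 minimises the mean of
  \<open>u (y + h)\<close>; this stands in for differentiating under the integral.\<close>

lemma u_translate_ge: "(\<integral>y. u y \<partial>N) \<le> (\<integral>y. u (y + h) \<partial>N)"
proof -
  have "(\<integral>y. u y - u (y + h) \<partial>N) \<le> (\<integral>y. exp (u y - u (y + h)) - 1 \<partial>N)"
  proof (rule integral_mono)
    show "u y - u (y + h) \<le> exp (u y - u (y + h)) - 1" for y
      using exp_ge_add_one_self[of "u y - u (y + h)"] by linarith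
  qed (auto intro: likelihood_ratio integrable_u_translate)
  also have "\<dots> = 0"
    using likelihood_ratio[of h] by (simp add: prob_space)
  finally show ?thesis
    using integrable_u_translate[of h] by simp
qed

definition \<mu> where "\<mu> = (\<integral>y. y \<partial>N)"

lemma integral_inner_N [simp]: "(\<integral>y. w \<bullet> y \<partial>N) = w \<bullet> \<mu>"
  unfolding \<mu>_def using integrable_id by (rule integral_inner_right)

definition variance_along where "variance_along w = (\<integral>y. (w \<bullet> y - w \<bullet> \<mu>)\<^sup>2 \<partial>N)"

lemma integrable_centered_square [simp]: "integrable N (\<lambda>y. (w \<bullet> y - c)\<^sup>2)"
  by (simp add: power2_diff)

lemma variance_along_eq: "variance_along w = (\<integral>y. (w \<bullet> y)\<^sup>2 \<partial>N) - (w \<bullet> \<mu>)\<^sup>2"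
proof -
  have "(\<lambda>y. (w \<bullet> y - w \<bullet> \<mu>)\<^sup>2) = (\<lambda>y. (w \<bullet> y)\<^sup>2 - 2 * (w \<bullet> \<mu>) * (w \<bullet> y) + (w \<bullet> \<mu>)\<^sup>2)"
    by (auto simp: power2_diff)
  then show ?thesis
    unfolding variance_along_def by (simp add: power2_eq_square)
qed

text \<open>Using \<open>u_upper\<close> at y + h in the directions h and -h cancels the gradient
  and bounds the second difference of u by \<open>quad Ap h\<close>. The squared ratio for h is
  therefore at most \<open>exp (quad Ap h)\<close> times the ratio for 2 h, which has mean 1. This
  bounds the chi-square divergence of the translate.\<close>

lemma likelihood_ratio_square:
  "integrable N (\<lambda>y. (exp (u y - u (y + h)))\<^sup>2)"
  "(\<integral>y. (exp (u y - u (y + h)))\<^sup>2 \<partial>N) \<le> exp (quad Ap h)"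
proof -
  have le: "(exp (u y - u (y + h)))\<^sup>2 \<le> exp (quad Ap h) * exp (u y - u (y + (h + h)))" for y
  proof -
    have "u (y + (h + h)) \<le> u (y + h) + g (y + h) \<bullet> h + quad Ap h / 2"
      using u_upper[of "y + h" h] by (simp add: add.assoc)
    moreover have "u y \<le> u (y + h) - g (y + h) \<bullet> h + quad Ap h / 2"
      using u_upper[of "y + h" "- h"] by simp
    moreover have "a \<le> b + c + d / 2 \<Longrightarrow> e \<le> b - c + d / 2 \<Longrightarrow> 2 * (e - b) \<le> d + (e - a)"
      for a b c d e :: real by (simp add: field_simps)
    ultimately have "2 * (u y - u (y + h)) \<le> quad Ap h + (u y - u (y + (h + h)))" by blast
    then show ?thesis by (simp flip: exp_double exp_add)
  qed
  have int: "integrable N (\<lambda>y. exp (quad Ap h) * exp (u y - u (y + (h + h))))"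
    by (intro integrable_mult_right likelihood_ratio)
  then show *: "integrable N (\<lambda>y. (exp (u y - u (y + h)))\<^sup>2)"
    by (rule Bochner_Integration.integrable_bound) (use le in auto)
  show "(\<integral>y. (exp (u y - u (y + h)))\<^sup>2 \<partial>N) \<le> exp (quad Ap h)"
    using integral_mono[OF * int le] likelihood_ratio(2)[of "h + h"] by simp
qed

text \<open>Hammersley-Chapman-Robbins: correlate \<open>w \<bullet> y\<close> with the likelihood ratio of an
  infinitesimal translation.\<close>

lemma cramer_rao: "2 * (w \<bullet> v) - quad Ap v \<le> variance_along w"
proof -
  have "(2 * (w \<bullet> v) - variance_along w) * \<tau> \<le> exp (quad Ap v * \<tau>) - 1" if "0 < \<tau>" for \<tau>
  proof -
    define h where "h = sqrt \<tau> *\<^sub>R v"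
    \<comment> \<open>The scale makes k (L - 1) of order one as \<tau> tends to 0. In the expanded
      square the cross term becomes -2 (w . v), and the chi-square part is bounded by (exp (\<tau> *
      quad Ap v) - 1) / \<tau>.\<close>
    define k where "k = 1 / sqrt \<tau>"
    define L where "L y = exp (u y - u (y + h))" for y
    define q where "q y = w \<bullet> y - w \<bullet> \<mu>" for y
    have [measurable]: "L \<in> borel_measurable borel" "q \<in> borel_measurable borel"
      unfolding L_def q_def by measurable
    have L: "integrable N L" "(\<integral>y. L y \<partial>N) = 1"
      using likelihood_ratio[of h] by (simp_all add: L_def[abs_def])
    have L2: "integrable N (\<lambda>y. (L y)\<^sup>2)" "(\<integral>y. (L y)\<^sup>2 \<partial>N) \<le> exp (quad Ap h)"
      using likelihood_ratio_square[of h] by (simp_all add: L_def)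
    have q: "integrable N q" "(\<integral>y. q y \<partial>N) = 0" "integrable N (\<lambda>y. (q y)\<^sup>2)"
      by (simp_all add: q_def[abs_def] prob_space)
    have "integrable N (\<lambda>y. q (y - h))"
      by (simp add: q_def inner_diff_right)
    from translate_N[OF _ this]
    have qL: "integrable N (\<lambda>y. q y * L y)" "(\<integral>y. q y * L y \<partial>N) = - (w \<bullet> h)"
      by (simp_all add: L_def q_def inner_diff_right prob_space)
    have "0 \<le> (\<integral>y. (q y + k * (L y - 1))\<^sup>2 \<partial>N)" by simp
    also have "(\<lambda>y. (q y + k * (L y - 1))\<^sup>2)
      = (\<lambda>y. (q y)\<^sup>2 + 2 * k * (q y * L y) - 2 * k * q y + k\<^sup>2 * (L y)\<^sup>2 - 2 * k\<^sup>2 * L y + k\<^sup>2)"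
      by (auto simp: power2_eq_square algebra_simps)
    also have "(\<integral>y. \<dots> y \<partial>N) = variance_along w - 2 * k * (w \<bullet> h) + k\<^sup>2 * (\<integral>y. (L y)\<^sup>2 \<partial>N) - k\<^sup>2"
      using L L2(1) q qL by (simp add: prob_space variance_along_def flip: q_def)
    also have "\<dots> \<le> variance_along w - 2 * k * (w \<bullet> h) + k\<^sup>2 * exp (quad Ap h) - k\<^sup>2"
      using L2(2) by (simp add: mult_left_mono)
    finally have "0 \<le> variance_along w - 2 * k * (w \<bullet> h) + k\<^sup>2 * exp (quad Ap h) - k\<^sup>2" .
    moreover have "2 * k * (w \<bullet> h) = 2 * (w \<bullet> v)" using that by (simp add: k_def h_def)
    moreover have "quad Ap h = quad Ap v * \<tau>" using that by (simp add: h_def quad_scaleR)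
    moreover have "k\<^sup>2 = 1 / \<tau>" using that by (simp add: k_def power_divide)
    ultimately have "0 \<le> variance_along w - 2 * (w \<bullet> v) + 1 / \<tau> * exp (quad Ap v * \<tau>) - 1 / \<tau>"
      by (simp only:)
    then have "0 \<le> \<tau> * (variance_along w - 2 * (w \<bullet> v) + 1 / \<tau> * exp (quad Ap v * \<tau>) - 1 / \<tau>)"
      using that by (intro mult_nonneg_nonneg) auto
    also have "\<dots> = \<tau> * variance_along w - 2 * \<tau> * (w \<bullet> v) + exp (quad Ap v * \<tau>) - 1"
      using that by (simp add: right_diff_distrib distrib_left)
    finally show ?thesis by (simp add: algebra_simps)
  qed
  then have "2 * (w \<bullet> v) - variance_along w \<le> quad Ap v"
    by (rule le_of_mult_le_exp_minus_one)
  then show ?thesis by linarith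
qed

lemma exp_inner_pos: "0 < (\<integral>y. exp (w \<bullet> y) \<partial>N)"
proof -
  have "(\<integral>y. exp (w \<bullet> y) \<partial>N) = (\<integral>y. exp (w \<bullet> y - u y) \<partial>lborel) / K"
    by (simp add: integral_N exp_diff exp_minus field_simps)
  moreover have "integrable lborel (\<lambda>y. exp (w \<bullet> y - u y))"
    using integrable_exp_inner[of w] by (subst (asm) integrable_N) (auto simp flip: exp_add)
  ultimately show ?thesis using K_pos integral_exp_pos[of "\<lambda>y. w \<bullet> y - u y"] by simp
qed

text \<open>Prekopa-Leindler for exp (-u) tilted by w and by -w. At the points z + h and z - h the
  tilts contribute 2 (w . h), while strong convexity costs at least \<open>quad Am h\<close> against
  2 u(z); completing the square around v bounds the surplus by \<open>quad Am v\<close>, uniformly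
  in h.\<close>

lemma laplace_product_le:
  "(\<integral>y. exp ((Am *v v) \<bullet> y) \<partial>N) * (\<integral>y. exp (- ((Am *v v) \<bullet> y)) \<partial>N) \<le> exp (quad Am v)"
proof -
  let ?w = "Am *v v"
  have nn: "(\<integral>\<^sup>+y. ennreal (exp (x \<bullet> y - u y)) \<partial>lborel) = ennreal (K * (\<integral>y. exp (x \<bullet> y) \<partial>N))" for x
  proof -
    have "integrable lborel (\<lambda>y. exp (x \<bullet> y) * exp (- u y))"
      using integrable_exp_inner[of x] by (subst (asm) integrable_N) auto
    then show ?thesis
      using K_pos by (subst nn_integral_eq_integral)
        (auto simp: integral_N exp_diff exp_minus field_simps)
  qed
  have "(\<integral>\<^sup>+y. ennreal (exp (?w \<bullet> y - u y)) \<partial>lborel) * (\<integral>\<^sup>+y. ennreal (exp ((- ?w) \<bullet> y - u y)) \<partial>lborel)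
    \<le> (\<integral>\<^sup>+y. ennreal (exp (quad Am v / 2) * exp (- u y)) \<partial>lborel)\<^sup>2"
  proof (rule prekopa_leindler)
    fix x y :: "real^'d"
    define z where "z = (1/2) *\<^sub>R (x + y)"
    define h where "h = (1/2) *\<^sub>R (x - y)"
    have xy: "x = z + h" "y = z + - h"
      by (simp_all add: z_def h_def algebra_simps flip: scaleR_add_left)
    have "0 \<le> quad Am (h - v)" by (rule quad_nonneg[OF Am])
    also have "\<dots> = quad Am h - 2 * (?w \<bullet> h) + quad Am v"
      by (simp add: quad_diff[OF sym_pos_def_symmetric[OF Am]] inner_commute)
    finally have "?w \<bullet> x - u x + ((- ?w) \<bullet> y - u y) \<le> quad Am v - 2 * u z"
      using u_lower[of z h] u_lower[of z "- h"] unfolding xy by (simp add: inner_add_right inner_diff_right)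
    then have "exp (?w \<bullet> x - u x) * exp ((- ?w) \<bullet> y - u y) \<le> (exp (quad Am v / 2) * exp (- u z))\<^sup>2"
      by (simp add: power_mult_distrib flip: exp_add exp_double)
    then show "ennreal (exp (?w \<bullet> x - u x)) * ennreal (exp ((- ?w) \<bullet> y - u y))
      \<le> (ennreal (exp (quad Am v / 2) * exp (- u ((1/2) *\<^sub>R (x + y)))))\<^sup>2"
      by (simp add: ennreal_power ennreal_leI flip: ennreal_mult z_def)
  qed measurable
  also have "(\<integral>\<^sup>+y. ennreal (exp (quad Am v / 2) * exp (- u y)) \<partial>lborel) = ennreal (exp (quad Am v / 2) * K)"
    unfolding K_def by (subst nn_integral_eq_integral) (auto intro: integrable_exp_u)
  finally have "ennreal (K * (\<integral>y. exp (?w \<bullet> y) \<partial>N)) * ennreal (K * (\<integral>y. exp ((- ?w) \<bullet> y) \<partial>N))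
    \<le> (ennreal (exp (quad Am v / 2) * K))\<^sup>2"
    unfolding nn .
  then have "(K * (\<integral>y. exp (?w \<bullet> y) \<partial>N)) * (K * (\<integral>y. exp ((- ?w) \<bullet> y) \<partial>N)) \<le> (exp (quad Am v / 2) * K)\<^sup>2"
    using K_pos exp_inner_pos[of ?w] exp_inner_pos[of "- ?w"]
    by (simp add: ennreal_power less_imp_le flip: ennreal_mult)
  then have "K\<^sup>2 * ((\<integral>y. exp (?w \<bullet> y) \<partial>N) * (\<integral>y. exp (- (?w \<bullet> y)) \<partial>N)) \<le> K\<^sup>2 * exp (quad Am v)"
    by (simp add: power2_eq_square mult_ac flip: exp_add)
  then show ?thesis using K_pos by simp
qed

lemma variance_along_le: "variance_along w \<le> (\<integral>y. (w \<bullet> y + c)\<^sup>2 \<partial>N)"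
proof -
  have "(\<lambda>y. (w \<bullet> y + c)\<^sup>2) = (\<lambda>y. (w \<bullet> y)\<^sup>2 + 2 * c * (w \<bullet> y) + c\<^sup>2)"
    by (auto simp: power2_sum)
  then have "(\<integral>y. (w \<bullet> y + c)\<^sup>2 \<partial>N) = (\<integral>y. (w \<bullet> y)\<^sup>2 \<partial>N) + 2 * (w \<bullet> \<mu>) * c + c\<^sup>2"
    by simp
  moreover have "0 \<le> (w \<bullet> \<mu> + c)\<^sup>2" by simp
  ultimately show ?thesis
    unfolding variance_along_eq by (simp add: power2_eq_square algebra_simps)
qed

text \<open>The variance is the second-order term of \<open>laplace_product_le\<close> in the size r
  of the tilt. Applying \<open>exp_sum_ge\<close> to r (w . y) + k makes this a pointwise estimate,
  and a suitable k lets the two exponential moments enter only through their product.\<close>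

lemma brascamp_lieb: "variance_along (Am *v v) \<le> quad Am v"
proof (rule le_of_mult_le_exp_minus_one)
  fix \<tau> :: real assume "0 < \<tau>"
  \<comment> \<open>The factor 2 matches the bound 2 (sqrt (a b) - 1) obtained below for r^2 times
    the variance.\<close>
  define r where "r = sqrt (2 * \<tau>)"
  have r: "0 < r" "r\<^sup>2 = 2 * \<tau>" using \<open>0 < \<tau>\<close> by (simp_all add: r_def)
  define w where "w = Am *v v"
  define a b where "a = (\<integral>y. exp ((r *\<^sub>R w) \<bullet> y) \<partial>N)" and "b = (\<integral>y. exp ((- r *\<^sub>R w) \<bullet> y) \<partial>N)"
  have ab: "0 < a" "0 < b" unfolding a_def b_def by (rule exp_inner_pos)+
  have "a * b \<le> exp (quad Am (r *\<^sub>R v))"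
    using laplace_product_le[of "r *\<^sub>R v"] by (simp add: a_def b_def w_def matrix_vector_mult_scaleR)
  also have "\<dots> = (exp (quad Am v * \<tau>))\<^sup>2"
    using r by (simp add: quad_scaleR mult_ac flip: exp_double)
  finally have sq: "sqrt (a * b) \<le> exp (quad Am v * \<tau>)"
    by (simp add: real_le_lsqrt)
  text \<open>The shift \<open>k\<close> balances the two exponential moments.\<close>
  define k where "k = (ln b - ln a) / 2"
  have "2 * k = ln (b / a)" "2 * (- k) = ln (a / b)"
    using ab by (simp_all add: k_def ln_div field_simps)
  then have "(exp k)\<^sup>2 = b / a" "(exp (- k))\<^sup>2 = a / b"
    using ab by (metis exp_double exp_ln divide_pos_pos)+
  then have "exp k = sqrt (b / a)" "exp (- k) = sqrt (a / b)"
    by (metis exp_ge_zero real_sqrt_unique)+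
  then have "sqrt a * exp k = sqrt b" "sqrt b * exp (- k) = sqrt a"
    using ab by (simp_all add: real_sqrt_divide)
  then have "sqrt a * sqrt a * exp k = sqrt (a * b)" "sqrt b * sqrt b * exp (- k) = sqrt (a * b)"
    by (simp_all only: mult.assoc real_sqrt_mult mult.commute[of "sqrt b" "sqrt a"])
  then have "exp k * a + exp (- k) * b = 2 * sqrt (a * b)"
    using ab by (simp add: mult.commute)
  moreover have "(\<integral>y. (r * (w \<bullet> y) + k)\<^sup>2 \<partial>N)
    \<le> (\<integral>y. exp k * exp ((r *\<^sub>R w) \<bullet> y) + exp (- k) * exp ((- r *\<^sub>R w) \<bullet> y) - 2 \<partial>N)"
  proof (rule integral_mono)
    show "integrable N (\<lambda>y. (r * (w \<bullet> y) + k)\<^sup>2)"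
      by (simp add: power2_sum power_mult_distrib)
    show "integrable N (\<lambda>y. exp k * exp ((r *\<^sub>R w) \<bullet> y) + exp (- k) * exp ((- r *\<^sub>R w) \<bullet> y) - 2)"
      using integrable_exp_inner[of "r *\<^sub>R w"] integrable_exp_inner[of "- r *\<^sub>R w"] by simp
    show "(r * (w \<bullet> y) + k)\<^sup>2 \<le> exp k * exp ((r *\<^sub>R w) \<bullet> y) + exp (- k) * exp ((- r *\<^sub>R w) \<bullet> y) - 2" for y
      using exp_sum_ge[of "r * (w \<bullet> y) + k"] by (simp add: add.commute flip: exp_add)
  qed
  moreover have "(\<integral>y. exp k * exp ((r *\<^sub>R w) \<bullet> y) + exp (- k) * exp ((- r *\<^sub>R w) \<bullet> y) - 2 \<partial>N)
    = exp k * a + exp (- k) * b - 2"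
    using integrable_exp_inner[of "r *\<^sub>R w"] integrable_exp_inner[of "- r *\<^sub>R w"]
    by (simp add: a_def b_def prob_space)
  moreover have "r\<^sup>2 * variance_along w \<le> (\<integral>y. (r * (w \<bullet> y) + k)\<^sup>2 \<partial>N)"
  proof -
    have "r\<^sup>2 * variance_along w \<le> r\<^sup>2 * (\<integral>y. (w \<bullet> y + k / r)\<^sup>2 \<partial>N)"
      by (intro mult_left_mono variance_along_le) simp
    also have "\<dots> = (\<integral>y. r\<^sup>2 * (w \<bullet> y + k / r)\<^sup>2 \<partial>N)" by simp
    also have "(\<lambda>y. r\<^sup>2 * (w \<bullet> y + k / r)\<^sup>2) = (\<lambda>y. (r * (w \<bullet> y) + k)\<^sup>2)"
      using r(1) by (simp add: distrib_left flip: power_mult_distrib)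
    finally show ?thesis .
  qed
  ultimately show "variance_along (Am *v v) * \<tau> \<le> exp (quad Am v * \<tau>) - 1"
    using sq r by (simp add: w_def mult_ac)
qed

end

section \<open>The distance between mode and mean\<close>

lemma quadratic_potential:
  assumes "sym_pos_def A"
  shows "sandwiched_potential (\<lambda>y. quad A y / 2) (\<lambda>y. A *v y) A A"
proof
  show "quad A y / 2 + (A *v y) \<bullet> h + quad A h / 2 \<le> quad A (y + h) / 2"
    "quad A (y + h) / 2 \<le> quad A y / 2 + (A *v y) \<bullet> h + quad A h / 2" for y h
    using symmetric_matrix_inner[OF sym_pos_def_symmetric[OF assms], of y h]
    by (simp_all add: quad_add[OF sym_pos_def_symmetric[OF assms]] inner_commute)
qed (use assms in auto)

text \<open>The locale is applied to the Gaussian itself. Its mean vanishes because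
  \<open>u_translate_ge\<close> for the shift by minus the mean would otherwise lower the expected
  energy by half the form of the mean; the second moment is then its variance, bounded by
  \<open>brascamp_lieb\<close>.\<close>

lemma gauss_moments:
  fixes A :: "real^'d^'d"
  assumes A: "sym_pos_def A"
  shows "integrable lborel (\<lambda>y. (w \<bullet> y) * exp (- quad A y / 2))"
    and "(\<integral>y. (w \<bullet> y) * exp (- quad A y / 2) \<partial>lborel) = 0"
    and "integrable lborel (\<lambda>y. (w \<bullet> y)\<^sup>2 * exp (- quad A y / 2))"
    and "(\<integral>y. ((A *v v) \<bullet> y)\<^sup>2 * exp (- quad A y / 2) \<partial>lborel) \<le> quad A v * gauss_integral A"
proof -
  note sym = sym_pos_def_symmetric[OF A]
  interpret m: sandwiched_potential "\<lambda>y. quad A y / 2" "\<lambda>y. A *v y" A A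
    by (rule quadratic_potential[OF A])
  have K: "m.K = gauss_integral A" by (simp add: m.K_def gauss_integral_def)
  have "(\<integral>y. quad A y / 2 \<partial>m.N) \<le> (\<integral>y. quad A (y + - m.\<mu>) / 2 \<partial>m.N)"
    by (rule m.u_translate_ge)
  also have "(\<lambda>y. quad A (y + - m.\<mu>) / 2) = (\<lambda>y. quad A y / 2 - (A *v m.\<mu>) \<bullet> y + quad A m.\<mu> / 2)"
    by (simp add: quad_diff[OF sym] inner_commute diff_divide_distrib add_divide_distrib)
  also have "(\<integral>y. \<dots> y \<partial>m.N) = (\<integral>y. quad A y / 2 \<partial>m.N) - quad A m.\<mu> / 2"
    by (simp add: inner_mult_self)
  finally have "quad A m.\<mu> \<le> 0" by simp
  then have \<mu>: "m.\<mu> = 0" using quad_pos[OF A, of m.\<mu>] by linarith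
  show "integrable lborel (\<lambda>y. (w \<bullet> y) * exp (- quad A y / 2))"
    using m.integrable_inner[of w] by (subst (asm) m.integrable_N) auto
  show "(\<integral>y. (w \<bullet> y) * exp (- quad A y / 2) \<partial>lborel) = 0"
    using m.integral_inner_N[of w] m.K_pos by (subst (asm) m.integral_N) (auto simp: \<mu>)
  show "integrable lborel (\<lambda>y. (w \<bullet> y)\<^sup>2 * exp (- quad A y / 2))"
    using m.integrable_inner_square[of w] by (subst (asm) m.integrable_N) auto
  have "(\<integral>y. ((A *v v) \<bullet> y)\<^sup>2 \<partial>m.N) \<le> quad A v"
    using m.brascamp_lieb[of v] by (simp add: m.variance_along_eq \<mu>)
  then show "(\<integral>y. ((A *v v) \<bullet> y)\<^sup>2 * exp (- quad A y / 2) \<partial>lborel) \<le> quad A v * gauss_integral A"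
    using m.K_pos by (subst (asm) m.integral_N) (auto simp: K field_simps)
qed

section \<open>Mass comparison and entropy bounds for the mean\<close>

context sandwiched_potential
begin

text \<open>By \<open>gauss_integral_ratio\<close> this is sqrt (det Am / det Ap). The mass
  \<open>K\<close> of exp (-u) lies between the two Gaussian masses.\<close>

definition c where "c = gauss_integral Ap / gauss_integral Am"

lemma gauss_le_K: "gauss_integral Ap \<le> K" and K_le_gauss: "K \<le> gauss_integral Am"
  unfolding gauss_integral_def K_def
  by (intro integral_mono integrable_gauss integrable_exp_u Am Ap; use u_bounds in auto)+

lemma c_pos: "0 < c" and c_le_1: "c \<le> 1"
  using gauss_integral_pos[OF Am] gauss_integral_pos[OF Ap] gauss_le_K K_le_gauss
  by (auto simp: c_def field_simps)

text \<open>The weights \<open>exp (- u) - exp (- quad Ap / 2)\<close> and \<open>exp (- quad Am / 2) - exp (- u)\<close> are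
  nonnegative and the Gaussians are centred, so Cauchy-Schwarz for each of them bounds the mean.\<close>

lemma mean_bound_comparison:
  defines "t \<equiv> quad Am \<mu>"
  shows "K\<^sup>2 * t\<^sup>2 * (gauss_integral Am - gauss_integral Ap)
    \<le> gauss_integral Am * t * (K - gauss_integral Ap) * (gauss_integral Am - K)"
    and "gauss_integral Am = gauss_integral Ap \<Longrightarrow> t = 0"
proof -
  let ?Zm = "gauss_integral Am" and ?Zp = "gauss_integral Ap"
  define w where "w = Am *v \<mu>"
  define A where "A = (\<integral>y. (w \<bullet> y)\<^sup>2 * exp (- u y) \<partial>lborel)"
  have w\<mu>: "w \<bullet> \<mu> = t" by (simp add: w_def t_def quad_def inner_commute)
  have iu: "integrable lborel (\<lambda>y. (w \<bullet> y) * exp (- u y))"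
    "integrable lborel (\<lambda>y. (w \<bullet> y)\<^sup>2 * exp (- u y))"
    using integrable_inner[of w] integrable_inner_square[of w] by (simp_all flip: integrable_N)
  have B: "(\<integral>y. (w \<bullet> y) * exp (- u y) \<partial>lborel) = K * t"
    using integral_N[of "\<lambda>y. w \<bullet> y"] K_pos by (simp add: w\<mu> field_simps)
  note gm = gauss_moments(1-3)[OF Am, of w] and gp = gauss_moments(1-3)[OF Ap, of w]
  note igm = integrable_gauss[OF Am] and igp = integrable_gauss[OF Ap]
  have "(\<integral>y. (w \<bullet> y) * (exp (- u y) - exp (- quad Ap y / 2)) \<partial>lborel)\<^sup>2
    \<le> (\<integral>y. (w \<bullet> y)\<^sup>2 * (exp (- u y) - exp (- quad Ap y / 2)) \<partial>lborel)
      * (\<integral>y. exp (- u y) - exp (- quad Ap y / 2) \<partial>lborel)"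
    by (rule weighted_cauchy_schwarz)
      (use u_bounds(2) iu gp igp integrable_exp_u in \<open>simp_all add: right_diff_distrib\<close>)
  also have "(\<integral>y. exp (- u y) - exp (- quad Ap y / 2) \<partial>lborel) = K - ?Zp"
    unfolding K_def gauss_integral_def using igp integrable_exp_u by (rule Bochner_Integration.integral_diff[rotated])
  also have "(\<integral>y. (w \<bullet> y) * (exp (- u y) - exp (- quad Ap y / 2)) \<partial>lborel) = K * t"
    unfolding right_diff_distrib using B gp iu by (subst Bochner_Integration.integral_diff) auto
  also have "(\<integral>y. (w \<bullet> y)\<^sup>2 * (exp (- u y) - exp (- quad Ap y / 2)) \<partial>lborel) * (K - ?Zp) \<le> A * (K - ?Zp)"
  proof (rule mult_right_mono)
    have "0 \<le> (\<integral>y. (w \<bullet> y)\<^sup>2 * exp (- quad Ap y / 2) \<partial>lborel)" by simp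
    then show "(\<integral>y. (w \<bullet> y)\<^sup>2 * (exp (- u y) - exp (- quad Ap y / 2)) \<partial>lborel) \<le> A"
      unfolding right_diff_distrib A_def using gp iu by (subst Bochner_Integration.integral_diff) auto
  qed (use gauss_le_K in simp)
  finally have 1: "(K * t)\<^sup>2 \<le> A * (K - ?Zp)" .
  have "(\<integral>y. (w \<bullet> y) * (exp (- quad Am y / 2) - exp (- u y)) \<partial>lborel)\<^sup>2
    \<le> (\<integral>y. (w \<bullet> y)\<^sup>2 * (exp (- quad Am y / 2) - exp (- u y)) \<partial>lborel)
      * (\<integral>y. exp (- quad Am y / 2) - exp (- u y) \<partial>lborel)"
    by (rule weighted_cauchy_schwarz)
      (use u_bounds(1) iu gm igm integrable_exp_u in \<open>simp_all add: right_diff_distrib\<close>)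
  also have "(\<integral>y. exp (- quad Am y / 2) - exp (- u y) \<partial>lborel) = ?Zm - K"
    unfolding K_def gauss_integral_def using igm integrable_exp_u by (rule Bochner_Integration.integral_diff)
  also have "(\<integral>y. (w \<bullet> y) * (exp (- quad Am y / 2) - exp (- u y)) \<partial>lborel) = - (K * t)"
    unfolding right_diff_distrib using B gm iu by (subst Bochner_Integration.integral_diff) auto
  also have "(\<integral>y. (w \<bullet> y)\<^sup>2 * (exp (- quad Am y / 2) - exp (- u y)) \<partial>lborel) * (?Zm - K) \<le> (?Zm * t - A) * (?Zm - K)"
  proof (rule mult_right_mono)
    show "(\<integral>y. (w \<bullet> y)\<^sup>2 * (exp (- quad Am y / 2) - exp (- u y)) \<partial>lborel) \<le> ?Zm * t - A"
      unfolding right_diff_distrib A_def using gm iu gauss_moments(4)[OF Am, of \<mu>]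
      by (subst Bochner_Integration.integral_diff) (auto simp: w_def t_def mult.commute)
  qed (use K_le_gauss in simp)
  finally have 2: "(K * t)\<^sup>2 \<le> (?Zm * t - A) * (?Zm - K)" by simp
  \<comment> \<open>The second moment A is unknown. Weighting each Cauchy-Schwarz bound by the mass
    difference of the other makes A cancel in the sum.\<close>
  have "(K * t)\<^sup>2 * (?Zm - K) + (K * t)\<^sup>2 * (K - ?Zp)
    \<le> A * (K - ?Zp) * (?Zm - K) + (?Zm * t - A) * (?Zm - K) * (K - ?Zp)"
    using 1 2 gauss_le_K K_le_gauss by (intro add_mono mult_right_mono) auto
  then show "K\<^sup>2 * t\<^sup>2 * (?Zm - ?Zp) \<le> ?Zm * t * (K - ?Zp) * (?Zm - K)"
    by (simp add: power_mult_distrib algebra_simps)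
  show "t = 0" if "?Zm = ?Zp"
    using 1 that K_pos gauss_le_K K_le_gauss by simp
qed

lemma mean_bound_moderate:
  assumes "1 / 4 \<le> c"
  shows "quad Am \<mu> \<le> 1 - c"
proof (cases "quad Am \<mu> = 0 \<or> c = 1")
  case True
  then show ?thesis
    using mean_bound_comparison(2) gauss_integral_pos[OF Am] c_le_1 by (auto simp: c_def)
next
  case False
  let ?Zm = "gauss_integral Am"
  define t where "t = quad Am \<mu>"
  define k where "k = K / ?Zm"
  have Z: "0 < ?Zm" by (rule gauss_integral_pos[OF Am])
  have t: "0 < t" using False quad_nonneg[OF Am, of \<mu>] by (simp add: t_def)
  have c1: "c < 1" using False c_le_1 by simp
  have k: "0 < k" using K_pos Z by (simp add: k_def)
  have eqs: "gauss_integral Ap = c * ?Zm" "K = k * ?Zm" using Z by (simp_all add: c_def k_def)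
  have "(?Zm^3 * t) * (k\<^sup>2 * t * (1 - c)) \<le> (?Zm^3 * t) * ((k - c) * (1 - k))"
    using mean_bound_comparison(1) unfolding t_def[symmetric] eqs
    by (simp add: power2_eq_square power3_eq_cube algebra_simps)
  then have "k\<^sup>2 * t * (1 - c) \<le> (k - c) * (1 - k)"
    using Z t by simp
  \<comment> \<open>Eliminates the unknown mass ratio k: this is the inequality of arithmetic and
    geometric means for k - c and c (1 - k), whose sum is k (1 - c). The outcome is 4 c t <= 1 -
    c.\<close>
  moreover have "4 * c * ((k - c) * (1 - k)) \<le> (k * (1 - c))\<^sup>2"
  proof -
    have "0 \<le> ((k - c) - c * (1 - k))\<^sup>2" by simp
    then show ?thesis by (simp add: power2_eq_square algebra_simps)
  qed
  ultimately have "4 * c * (k\<^sup>2 * t * (1 - c)) \<le> (k * (1 - c))\<^sup>2"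
    using c_pos by (meson mult_left_mono less_imp_le mult_pos_pos order_trans zero_less_numeral)
  then have "(k\<^sup>2 * (1 - c)) * (4 * c * t) \<le> (k\<^sup>2 * (1 - c)) * (1 - c)"
    by (simp add: power2_eq_square mult_ac)
  then have "4 * c * t \<le> 1 - c" using k c1 by simp
  moreover have "1 * t \<le> 4 * c * t" using assms t by (intro mult_right_mono) auto
  ultimately show ?thesis by (simp add: t_def)
qed

text \<open>J is the logarithm of the ratio of a Gaussian weight centred at \<mu> to exp (-u), so
  exp J has mean Zm / K, which is at most 1 / c. Jensen, in the form of the tangent bound for exp,
  then bounds the mean of J. The mass is the same for every centre, and the centre \<mu> makes the
  mean of J largest; this is what yields the extra t / 2.\<close>

lemma mean_excess_upper:
  "(\<integral>y. u y \<partial>N) - (\<integral>y. quad Am y \<partial>N) / 2 \<le> - quad Am \<mu> / 2 - ln c"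
proof -
  let ?Zm = "gauss_integral Am"
  note sym = sym_pos_def_symmetric[OF Am]
  define J where "J y = u y - quad Am (y - \<mu>) / 2" for y
  have Jq: "J = (\<lambda>y. u y - quad Am y / 2 + (Am *v \<mu>) \<bullet> y - quad Am \<mu> / 2)"
    by (auto simp: J_def quad_diff[OF sym] inner_commute field_simps)
  have J: "integrable N J" unfolding Jq by simp
  have EJ: "(\<integral>y. J y \<partial>N) = (\<integral>y. u y \<partial>N) - (\<integral>y. quad Am y \<partial>N) / 2 + quad Am \<mu> / 2"
    unfolding Jq by (simp add: inner_mult_self)
  have eq: "exp (J y) * exp (- u y) = exp (- quad Am (- \<mu> + y) / 2)" for y
    by (simp add: J_def flip: exp_add)
  have J_measurable: "(\<lambda>y. exp (J y)) \<in> borel_measurable borel"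
    unfolding J_def by measurable
  have tr: "(\<lambda>y. exp (J y) * exp (- u y)) = (\<lambda>y. (\<lambda>y. exp (- quad Am y / 2)) (- \<mu> + y))"
    by (simp only: eq)
  have iJ: "integrable N (\<lambda>y. exp (J y))"
    using integrable_gauss[OF Am] unfolding integrable_N[OF J_measurable] tr
    by (subst integrable_lborel_translate) auto
  have "(\<integral>y. exp (J y) \<partial>N) = ?Zm / K"
    unfolding integral_N[OF J_measurable] tr gauss_integral_def
    by (subst integrable_lborel_translate) auto
  moreover have "(\<integral>y. J y + ln (K / ?Zm) \<partial>N) \<le> (\<integral>y. (K / ?Zm) * exp (J y) - 1 \<partial>N)"
  proof (rule integral_mono)
    fix y
    have "0 < K / ?Zm" using K_pos gauss_integral_pos[OF Am] by simp
    then have "(K / ?Zm) * exp (J y) = exp (J y + ln (K / ?Zm))" by (simp add: exp_add)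
    then show "J y + ln (K / ?Zm) \<le> (K / ?Zm) * exp (J y) - 1"
      using exp_ge_add_one_self[of "J y + ln (K / ?Zm)"] by linarith
  qed (use J iJ in auto)
  ultimately have "(\<integral>y. J y \<partial>N) + ln (K / ?Zm) \<le> 0"
    using J iJ K_pos gauss_integral_pos[OF Am] by simp
  moreover have "ln c \<le> ln (K / ?Zm)"
    using c_pos gauss_le_K gauss_integral_pos[OF Am] by (simp add: c_def divide_right_mono ln_mono)
  ultimately show ?thesis using EJ by linarith
qed

text \<open>Shift by \<kappa> \<mu>, that is, further away from the mode. The quadratic minorant at
  the shifted point grows linearly in \<kappa>, at rate t, because \<mu> is the mean. The mean of u
  has no first-order growth, since the zero shift minimises it, and its second-order growth is
  controlled by \<open>quad Ap \<mu>\<close>. Comparing the two gives the claim.\<close>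

lemma mean_excess_lower:
  assumes "0 \<le> \<kappa>"
  shows "\<kappa> * quad Am \<mu> - \<kappa>\<^sup>2 / 2 * (quad Ap \<mu> - quad Am \<mu>) \<le> (\<integral>y. u y \<partial>N) - (\<integral>y. quad Am y \<partial>N) / 2"
proof -
  note sym = sym_pos_def_symmetric[OF Am]
  have "(\<integral>y. u (y + \<kappa> *\<^sub>R \<mu>) \<partial>N) \<le> (\<integral>y. u y \<partial>N) + \<kappa>\<^sup>2 / 2 * quad Ap \<mu>"
  proof (rule field_le_epsilon)
    fix e :: real assume "0 < e"
    \<comment> \<open>Makes the error term at most e / 2; the summand 1 keeps the denominator
      positive when \<kappa> or \<mu> vanishes.\<close>
    define \<epsilon> where "\<epsilon> = e / (\<kappa> * quad Ap \<mu> + 1)"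
    have Q: "0 \<le> \<kappa> * quad Ap \<mu>" using assms quad_nonneg[OF Ap] by simp
    then have \<epsilon>: "0 < \<epsilon>" using \<open>0 < e\<close> by (simp add: \<epsilon>_def)
    have "\<epsilon> * (\<kappa> * quad Ap \<mu>) \<le> e"
      using Q \<open>0 < e\<close> by (simp add: \<epsilon>_def divide_le_eq distrib_left)
    \<comment> \<open>A forward shift of size \<kappa> with weight \<epsilon> and a backward shift
      of size \<epsilon> with weight \<kappa>: the gradient terms cancel, so the mean of g never has
      to be computed.\<close>
    have pt: "\<epsilon> * u (y + \<kappa> *\<^sub>R \<mu>) \<le> (\<kappa> + \<epsilon>) * u y - \<kappa> * u (y + (- \<epsilon>) *\<^sub>R \<mu>) + \<epsilon> * \<kappa> * (\<kappa> + \<epsilon>) * quad Ap \<mu> / 2" for y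
    proof -
      have "\<epsilon> * u (y + \<kappa> *\<^sub>R \<mu>) + \<kappa> * u (y + (- \<epsilon>) *\<^sub>R \<mu>)
        \<le> \<epsilon> * (u y + \<kappa> * (g y \<bullet> \<mu>) + \<kappa>\<^sup>2 * quad Ap \<mu> / 2)
          + \<kappa> * (u y - \<epsilon> * (g y \<bullet> \<mu>) + \<epsilon>\<^sup>2 * quad Ap \<mu> / 2)"
        using u_upper[of y "\<kappa> *\<^sub>R \<mu>"] u_upper[of y "(- \<epsilon>) *\<^sub>R \<mu>"] assms \<epsilon>
        by (intro add_mono mult_left_mono) (auto simp: quad_scaleR)
      then show ?thesis by (simp add: power2_eq_square algebra_simps add_divide_distrib)
    qed
    have "\<epsilon> * (\<integral>y. u (y + \<kappa> *\<^sub>R \<mu>) \<partial>N) = (\<integral>y. \<epsilon> * u (y + \<kappa> *\<^sub>R \<mu>) \<partial>N)" by simp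
    also have "\<dots> \<le> (\<integral>y. (\<kappa> + \<epsilon>) * u y - \<kappa> * u (y + (- \<epsilon>) *\<^sub>R \<mu>) + \<epsilon> * \<kappa> * (\<kappa> + \<epsilon>) * quad Ap \<mu> / 2 \<partial>N)"
      by (intro integral_mono pt Bochner_Integration.integrable_add Bochner_Integration.integrable_diff
          integrable_mult_right integrable_u_translate integrable_u) simp
    also have "\<dots> = (\<kappa> + \<epsilon>) * (\<integral>y. u y \<partial>N) - \<kappa> * (\<integral>y. u (y + (- \<epsilon>) *\<^sub>R \<mu>) \<partial>N) + \<epsilon> * \<kappa> * (\<kappa> + \<epsilon>) * quad Ap \<mu> / 2"
      using integrable_u_translate[of "(- \<epsilon>) *\<^sub>R \<mu>"] by simp
    also have "\<dots> \<le> (\<kappa> + \<epsilon>) * (\<integral>y. u y \<partial>N) - \<kappa> * (\<integral>y. u y \<partial>N) + \<epsilon> * \<kappa> * (\<kappa> + \<epsilon>) * quad Ap \<mu> / 2"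
      using mult_left_mono[OF u_translate_ge[of "(- \<epsilon>) *\<^sub>R \<mu>"] assms] by linarith
    also have "\<dots> = \<epsilon> * ((\<integral>y. u y \<partial>N) + \<kappa>\<^sup>2 / 2 * quad Ap \<mu> + \<epsilon> * (\<kappa> * quad Ap \<mu>) / 2)"
      by (simp add: power2_eq_square algebra_simps)
    finally have "(\<integral>y. u (y + \<kappa> *\<^sub>R \<mu>) \<partial>N) \<le> (\<integral>y. u y \<partial>N) + \<kappa>\<^sup>2 / 2 * quad Ap \<mu> + \<epsilon> * (\<kappa> * quad Ap \<mu>) / 2"
      using \<epsilon> by simp
    then show "(\<integral>y. u (y + \<kappa> *\<^sub>R \<mu>) \<partial>N) \<le> (\<integral>y. u y \<partial>N) + \<kappa>\<^sup>2 / 2 * quad Ap \<mu> + e"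
      using \<open>\<epsilon> * (\<kappa> * quad Ap \<mu>) \<le> e\<close> \<open>0 < e\<close> by linarith
  qed
  moreover have "(\<integral>y. quad Am (y + \<kappa> *\<^sub>R \<mu>) / 2 \<partial>N) \<le> (\<integral>y. u (y + \<kappa> *\<^sub>R \<mu>) \<partial>N)"
    using integrable_quad_translate[OF sym] integrable_u_translate u_bounds(1)
    by (intro integral_mono) auto
  moreover have "(\<lambda>y. quad Am (y + \<kappa> *\<^sub>R \<mu>) / 2) = (\<lambda>y. quad Am y / 2 + \<kappa> * ((Am *v \<mu>) \<bullet> y) + \<kappa>\<^sup>2 / 2 * quad Am \<mu>)"
    by (simp add: quad_add[OF sym] quad_scaleR inner_commute matrix_vector_mult_scaleR field_simps)
  then have "(\<integral>y. quad Am (y + \<kappa> *\<^sub>R \<mu>) / 2 \<partial>N)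
    = (\<integral>y. quad Am y \<partial>N) / 2 + \<kappa> * quad Am \<mu> + \<kappa>\<^sup>2 / 2 * quad Am \<mu>"
    by (simp add: inner_mult_self)
  ultimately show ?thesis by (simp add: right_diff_distrib)
qed

lemma mean_bound:
  assumes "quad Ap \<mu> < 1"
  shows "quad Am \<mu> \<le> 1 - c"
proof (cases "1 / 4 \<le> c")
  case True
  then show ?thesis by (rule mean_bound_moderate)
next
  case False
  define t where "t = quad Am \<mu>"
  have t: "0 \<le> t" "t < 1"
    using quad_nonneg[OF Am] quad_Am_le_Ap[of \<mu>] assms by (auto simp: t_def)
  \<comment> \<open>Since \<open>quad Ap \<mu>\<close> is below 1, the lower bound is at least
    \<kappa> t - \<kappa>^2 (1 - t) / 2. This \<kappa> maximises that expression, and 1 + \<kappa>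
    is exactly 1 / (1 - t).\<close>
  define \<kappa> where "\<kappa> = t / (1 - t)"
  have \<kappa>: "0 \<le> \<kappa>" "\<kappa> * (1 - t) = t" using t by (simp_all add: \<kappa>_def)
  have "\<kappa>\<^sup>2 / 2 * (quad Ap \<mu> - t) \<le> \<kappa>\<^sup>2 / 2 * (1 - t)"
    using assms by (intro mult_left_mono) auto
  also have "\<dots> = \<kappa> * t / 2" using \<kappa>(2) by (simp add: power2_eq_square mult.assoc)
  finally have "\<kappa> * t / 2 \<le> - t / 2 - ln c"
    using mean_excess_lower[OF \<kappa>(1)] mean_excess_upper unfolding t_def[symmetric] by linarith
  moreover have "\<kappa> * t + t = \<kappa>"
    using \<kappa>(2) by (simp add: algebra_simps)
  ultimately have "\<kappa> \<le> 2 * ln (1 / c)" using c_pos by (simp add: ln_div)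
  also have "ln (1 / c) = ln (1 / (4 * c)) + 2 * ln 2"
    using c_pos ln_mult[of 2 "2::real"] by (simp add: ln_div ln_mult)
  \<comment> \<open>The logarithm is bounded by its tangent after splitting off the factor 4,
    because 1/c starts at 4 in this case. The fraction 25/36 is a rational upper bound of ln 2,
    sharp enough for the slack available there.\<close>
  also have "\<dots> \<le> (1 / (4 * c) - 1) + 2 * (25 / 36)"
    using c_pos ln2_le_25_over_36 by (intro add_mono ln_le_minus_one) auto
  finally have "1 + \<kappa> \<le> 2 + 1 / (2 * c)" using c_pos by (simp add: field_simps)
  also have "\<dots> \<le> 1 / c" using False c_pos by (simp add: field_simps)
  finally have "1 + \<kappa> \<le> 1 / c" .
  moreover have "1 + \<kappa> = 1 / (1 - t)" using t by (simp add: \<kappa>_def field_simps)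
  ultimately have "1 / (1 - t) \<le> 1 / c" by simp
  then have "c \<le> 1 - t" using c_pos t by (simp add: field_simps)
  then show ?thesis by (simp add: t_def)
qed

end

section \<open>Taylor bounds and the Loewner order\<close>

lemma symmetric_matrixI:
  assumes "\<And>v w. v \<bullet> (A *v w) = w \<bullet> (A *v v)"
  shows "symmetric_matrix A"
proof -
  have e: "A $ i $ j = axis i 1 \<bullet> (A *v axis j 1)" for i j
    by (simp add: inner_axis' matrix_vector_mult_basis column_def)
  have "A $ j $ i = A $ i $ j" for i j
    unfolding e by (rule assms)
  then show ?thesis by (simp add: symmetric_matrix_def transpose_def vec_eq_iff)
qed

lemma loewner_le_iff:
  "A \<preceq>\<^sub>L B \<longleftrightarrow> symmetric_matrix A \<and> symmetric_matrix B \<and> (\<forall>v. quad A v \<le> quad B v)"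
  by (simp add: loewner_le_def quad_def matrix_vector_mult_diff_rdistrib inner_diff_right)

lemma gradient_inner:
  assumes "f differentiable (at x)"
  shows "frechet_derivative f (at x) v = gradient f x \<bullet> v"
proof -
  have lin: "linear (frechet_derivative f (at x))"
    using assms by (simp add: linear_frechet_derivative)
  have "frechet_derivative f (at x) v = frechet_derivative f (at x) (\<Sum>i\<in>UNIV. v $ i *\<^sub>R axis i 1)"
    using basis_expansion[of v] by (simp add: scalar_mult_eq_scaleR)
  also have "\<dots> = (\<Sum>i\<in>UNIV. v $ i * frechet_derivative f (at x) (axis i 1))"
    by (simp add: linear_sum[OF lin] linear_scale[OF lin])
  also have "\<dots> = gradient f x \<bullet> v"
    by (simp add: gradient_def inner_vec_def mult.commute)
  finally show ?thesis .
qed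

lemma has_derivative_gradient:
  assumes "f differentiable (at x)"
  shows "(f has_derivative (\<lambda>v. gradient f x \<bullet> v)) (at x)"
proof -
  have "frechet_derivative f (at x) = (\<lambda>v. gradient f x \<bullet> v)"
    using gradient_inner[OF assms] by blast
  then show ?thesis using assms unfolding frechet_derivative_works by simp
qed

lemma has_derivative_hessian:
  assumes "gradient f differentiable (at x)"
  shows "(gradient f has_derivative (\<lambda>v. hessian f x *v v)) (at x)"
proof -
  have "frechet_derivative (gradient f) (at x) = (\<lambda>v. hessian f x *v v)"
    unfolding hessian_def using linear_frechet_derivative[OF assms] by (simp add: matrix_works)
  then show ?thesis using assms unfolding frechet_derivative_works by simp
qed

lemma taylor_line:
  fixes U :: "real^'d \<Rightarrow> real"
  assumes "C2 U"
  shows "\<exists>t. U (x + h) = U x + gradient U x \<bullet> h + quad (hessian U (x + t *\<^sub>R h)) h / 2"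
proof -
  \<comment> \<open>The derivatives of U along the segment, in the indexed form of Taylor's theorem.
    Only the orders 0, 1 and 2 are meaningful.\<close>
  define \<phi> where "\<phi> m r = (if m = 0 then U (x + r *\<^sub>R h)
    else if m = 1 then gradient U (x + r *\<^sub>R h) \<bullet> h else quad (hessian U (x + r *\<^sub>R h)) h)"
    for m :: nat and r :: real
  have line: "((\<lambda>r. x + r *\<^sub>R h) has_derivative (\<lambda>r. r *\<^sub>R h)) (at t)" for t :: real
    by (auto intro!: derivative_eq_intros)
  have \<phi>: "\<phi> 0 = (\<lambda>r. U (x + r *\<^sub>R h))" "\<phi> 1 = (\<lambda>r. gradient U (x + r *\<^sub>R h) \<bullet> h)"
    "\<phi> 2 = (\<lambda>r. quad (hessian U (x + r *\<^sub>R h)) h)"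
    by (auto simp: \<phi>_def)
  have 0: "(\<phi> 0 has_real_derivative \<phi> 1 t) (at t)" for t
  proof -
    have "(U has_derivative (\<lambda>v. gradient U (x + t *\<^sub>R h) \<bullet> v)) (at (x + t *\<^sub>R h))"
      using assms unfolding C2_def by (intro has_derivative_gradient) blast
    from has_derivative_compose[OF line this] show ?thesis
      unfolding \<phi> has_field_derivative_def by (simp add: mult_commute_abs)
  qed
  have 1: "(\<phi> 1 has_real_derivative \<phi> 2 t) (at t)" for t
  proof -
    have "(gradient U has_derivative (\<lambda>v. hessian U (x + t *\<^sub>R h) *v v)) (at (x + t *\<^sub>R h))"
      using assms unfolding C2_def by (intro has_derivative_hessian) blast
    from has_derivative_inner_left[OF has_derivative_compose[OF line this], of h]
    show ?thesis
      unfolding \<phi> has_field_derivative_def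
      by (simp add: quad_def matrix_vector_mult_scaleR inner_commute[of h] mult_commute_abs)
  qed
  have "\<exists>t>0. t < 1 \<and> \<phi> 0 1 = (\<Sum>m<2. (\<phi> m 0 / fact m) * (1 - 0) ^ m) + (\<phi> 2 t / fact 2) * (1 - 0)\<^sup>2"
  proof (rule Taylor_up[of 2 \<phi> "\<phi> 0" 0 1 0])
    show "\<forall>m t. m < 2 \<and> 0 \<le> t \<and> t \<le> 1 \<longrightarrow> (\<phi> m has_real_derivative \<phi> (Suc m) t) (at t)"
      using 0 1 by (auto simp: numeral_2_eq_2 less_Suc_eq)
  qed auto
  then obtain t where "\<phi> 0 1 = \<phi> 0 0 + \<phi> 1 0 + \<phi> 2 t / 2"
    by (auto simp: numeral_2_eq_2)
  then show ?thesis by (auto simp: \<phi>_def)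
qed

lemma taylor_bounds:
  fixes U :: "real^'d \<Rightarrow> real"
  assumes "C2 U" and "\<And>x. A \<preceq>\<^sub>L hessian U x" "\<And>x. hessian U x \<preceq>\<^sub>L B"
  shows "U x + gradient U x \<bullet> h + quad A h / 2 \<le> U (x + h)"
    and "U (x + h) \<le> U x + gradient U x \<bullet> h + quad B h / 2"
proof -
  obtain t where "U (x + h) = U x + gradient U x \<bullet> h + quad (hessian U (x + t *\<^sub>R h)) h / 2"
    using taylor_line[OF assms(1)] by blast
  then show "U x + gradient U x \<bullet> h + quad A h / 2 \<le> U (x + h)"
    "U (x + h) \<le> U x + gradient U x \<bullet> h + quad B h / 2"
    using assms(2,3)[of "x + t *\<^sub>R h"] by (auto simp: loewner_le_iff)
qed

lemma gradient_zero_at_minimum: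
  assumes "C2 U" "\<And>x. U z \<le> U x"
  shows "gradient U z = 0"
proof -
  have "U differentiable (at z)" using assms(1) by (simp add: C2_def)
  then have "(U has_derivative (\<lambda>v. gradient U z \<bullet> v)) (at z)"
    by (rule has_derivative_gradient)
  then have "(\<lambda>v. gradient U z \<bullet> v) = (\<lambda>v. 0)"
    using assms(2) by (intro differential_zero_maxmin[of z UNIV U]) auto
  then show ?thesis by (metis inner_eq_zero_iff)
qed

text \<open>Polarisation expresses x . A v through the form at x + v and x - v, and the
  parallelogram law adds up the two bounds.\<close>

lemma op_norm_le_of_quad_bound:
  assumes sym: "symmetric_matrix A" and b: "\<And>v. \<bar>quad A v\<bar> \<le> b * (norm v)\<^sup>2"
  shows "op_norm A \<le> b"
  unfolding op_norm_def
proof (rule onorm_le)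
  fix v
  show "norm (A *v v) \<le> b * norm v"
  proof (cases "A *v v = 0 \<or> v = 0")
    case True
    have "0 \<le> b * (norm v)\<^sup>2" using b[of v] by linarith
    then have "v \<noteq> 0 \<Longrightarrow> 0 \<le> b" by (simp add: zero_le_mult_iff)
    then show ?thesis using True by (cases "v = 0") auto
  next
    case False
    \<comment> \<open>The image A v rescaled to the length of v: then x . A v equals norm v * norm
      (A v), and the parallelogram sum is 4 (norm v)^2.\<close>
    define x where "x = (norm v / norm (A *v v)) *\<^sub>R (A *v v)"
    have x: "norm x = norm v" using False by (simp add: x_def)
    have "4 * (x \<bullet> (A *v v)) = quad A (x + v) - quad A (x - v)"
      by (simp add: quad_add[OF sym] quad_diff[OF sym])
    also have "\<dots> \<le> b * (norm (x + v))\<^sup>2 + b * (norm (x - v))\<^sup>2"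
      using b[of "x + v"] b[of "x - v"] by linarith
    also have "\<dots> = b * ((norm (x + v))\<^sup>2 + (norm (x - v))\<^sup>2)"
      by (simp add: distrib_left)
    also have "(norm (x + v))\<^sup>2 + (norm (x - v))\<^sup>2 = 2 * (norm x)\<^sup>2 + 2 * (norm v)\<^sup>2"
      by (simp add: power2_norm_eq_inner inner_simps)
    also have "x \<bullet> (A *v v) = norm v * norm (A *v v)"
      using False by (simp add: x_def power2_norm_eq_inner[symmetric] power2_eq_square)
    finally have "norm v * norm (A *v v) \<le> norm v * (b * norm v)"
      by (simp add: x power2_eq_square mult_ac)
    then show ?thesis using False by simp
  qed
qed

lemma quad_le_op_norm: "quad A v \<le> op_norm A * (norm v)\<^sup>2"
proof -
  have "quad A v \<le> norm v * norm (A *v v)" unfolding quad_def by (rule norm_cauchy_schwarz)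
  also have "\<dots> \<le> norm v * (op_norm A * norm v)"
    unfolding op_norm_def by (intro mult_left_mono onorm matrix_vector_mul_bounded_linear) simp
  finally show ?thesis by (simp add: power2_eq_square mult_ac)
qed

lemma quad_matrix_diff: "quad (A - B) v = quad A v - quad B v"
  by (simp add: quad_def matrix_vector_mult_diff_rdistrib inner_diff_right)

lemma symmetric_matrix_diff:
  "symmetric_matrix A \<Longrightarrow> symmetric_matrix B \<Longrightarrow> symmetric_matrix (A - B)"
  by (simp add: symmetric_matrix_def transpose_def vec_eq_iff)

text \<open>H - R lies below B - P, and R - H below Q - A. For a symmetric matrix such two-sided
  control of the quadratic form is control of the operator norm.\<close>

lemma op_norm_diff_le:
  assumes "A \<preceq>\<^sub>L H" "H \<preceq>\<^sub>L B" "P \<preceq>\<^sub>L R" "R \<preceq>\<^sub>L Q"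
  shows "op_norm (H - R) \<le> max (op_norm (B - P)) (op_norm (Q - A))"
proof (rule op_norm_le_of_quad_bound)
  show "symmetric_matrix (H - R)" using assms by (intro symmetric_matrix_diff) (auto simp: loewner_le_iff)
  fix v
  have "quad (H - R) v \<le> quad (B - P) v" "- quad (H - R) v \<le> quad (Q - A) v"
    using assms by (simp_all add: loewner_le_iff quad_matrix_diff diff_mono)
  then have "\<bar>quad (H - R) v\<bar> \<le> max (op_norm (B - P) * (norm v)\<^sup>2) (op_norm (Q - A) * (norm v)\<^sup>2)"
    using quad_le_op_norm[of "B - P" v] quad_le_op_norm[of "Q - A" v] by linarith
  then show "\<bar>quad (H - R) v\<bar> \<le> max (op_norm (B - P)) (op_norm (Q - A)) * (norm v)\<^sup>2"
    by (simp add: max_mult_distrib_right)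
qed

section \<open>Rank-one corrections and inverse matrices\<close>

lemma rank_one_update_mult:
  "((mat 1 + k *\<^sub>R (A ** outer_product m m)) ** A) *v v = A *v v + (k * (m \<bullet> (A *v v))) *\<^sub>R (A *v m)"
proof -
  have "outer_product m m *v w = (m \<bullet> w) *\<^sub>R m" for w
    by (simp add: outer_product_def matrix_vector_mult_def vec_eq_iff inner_vec_def sum_distrib_left
        sum_distrib_right mult_ac)
  then show ?thesis
    by (simp add: matrix_vector_mul_assoc[symmetric] matrix_vector_mult_add_rdistrib
        scaleR_matrix_vector_assoc[symmetric] matrix_vector_mult_scaleR)
qed

lemma trace_outer: "trace (A ** outer_product m m) = quad A m"
  by (simp add: trace_def matrix_matrix_mult_def outer_product_def quad_def inner_vec_def
      matrix_vector_mult_def sum_distrib_left mult_ac)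

text \<open>\<open>A ** outer_product m m\<close> need not be symmetric, but a further factor A on
  the right turns it into the outer product of A m with itself.\<close>

lemma rank_one_update:
  fixes A :: "real^'d^'d" and m :: "real^'d" and c k :: real
  assumes sym: "symmetric_matrix A"
  defines "P \<equiv> c *\<^sub>R ((mat 1 + k *\<^sub>R (A ** outer_product m m)) ** A)"
  shows "symmetric_matrix P" and "quad P v = c * (quad A v + k * (v \<bullet> (A *v m))\<^sup>2)"
proof -
  have P: "P *v w = c *\<^sub>R (A *v w + (k * (m \<bullet> (A *v w))) *\<^sub>R (A *v m))" for w
    unfolding P_def by (simp add: scaleR_matrix_vector_assoc[symmetric] rank_one_update_mult)
  note s = symmetric_matrix_inner[OF sym]
  show "symmetric_matrix P"
  proof (rule symmetric_matrixI)
    fix v w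
    show "v \<bullet> (P *v w) = w \<bullet> (P *v v)"
      using s[of v w] s[of m w] s[of m v] by (simp add: P inner_add_right)
  qed
  show "quad P v = c * (quad A v + k * (v \<bullet> (A *v m))\<^sup>2)"
    using s[of m v] by (simp add: quad_def P inner_add_right power2_eq_square)
qed

lemma matrix_inv_mult:
  assumes "invertible A"
  shows "A ** matrix_inv A = mat 1" "matrix_inv A ** A = mat 1"
proof -
  have "\<exists>B. A ** B = mat 1 \<and> B ** A = mat 1" using assms by (simp add: invertible_def)
  then have "A ** matrix_inv A = mat 1 \<and> matrix_inv A ** A = mat 1"
    unfolding matrix_inv_def by (rule someI_ex)
  then show "A ** matrix_inv A = mat 1" "matrix_inv A ** A = mat 1" by auto
qed

lemma det_matrix_inv:
  fixes A :: "real^'d^'d"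
  assumes "sym_pos_def A"
  shows "det (matrix_inv A) = 1 / det A"
proof -
  have "invertible A" using det_pos[OF assms] by (simp add: invertible_det_nz)
  from arg_cong[OF matrix_inv_mult(1)[OF this], of det]
  show ?thesis using det_pos[OF assms] by (simp add: det_mul field_simps)
qed

text \<open>Both premises are free of inverses, which is how the variance bounds are available. The
  first is used at w = S^-1 v. For the second, the nonnegative form of S at A v - S^-1 v is
  expanded, and the cross term is -2 \<open>quad A v\<close>.\<close>

lemma loewner_matrix_inv_le:
  fixes S :: "real^'d^'d"
  assumes S: "sym_pos_def S" and A: "sym_pos_def A" and B: "sym_pos_def B"
    and up: "\<And>v w. 2 * (w \<bullet> v) - quad B v \<le> quad S w"
    and lo: "\<And>v. quad S (A *v v) \<le> quad A v"
  shows "A \<preceq>\<^sub>L matrix_inv S" "matrix_inv S \<preceq>\<^sub>L B"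
proof -
  note symS = sym_pos_def_symmetric[OF S]
  let ?P = "matrix_inv S"
  have "invertible S" using det_pos[OF S] by (simp add: invertible_det_nz)
  then have SP: "S *v (?P *v v) = v" for v
    by (simp add: matrix_vector_mul_assoc matrix_inv_mult)
  have symP: "symmetric_matrix ?P"
  proof (rule symmetric_matrixI)
    fix v w
    show "v \<bullet> (?P *v w) = w \<bullet> (?P *v v)"
      using symmetric_matrix_inner[OF symS, of "?P *v w" "?P *v v"] SP by (simp add: inner_commute)
  qed
  have P: "quad ?P v = quad S (?P *v v)" for v
    by (simp add: quad_def SP inner_commute)
  have "quad ?P v \<le> quad B v" for v
    using up[of "?P *v v" v] P[of v] by (simp add: quad_def inner_commute)
  moreover have "quad A v \<le> quad ?P v" for v
  proof -
    have "0 \<le> quad S (A *v v - ?P *v v)" by (rule quad_nonneg[OF S])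
    also have "\<dots> = quad S (A *v v) - 2 * ((A *v v) \<bullet> v) + quad ?P v"
      by (simp add: quad_diff[OF symS] SP P)
    finally show ?thesis using lo[of v] by (simp add: inner_mult_self)
  qed
  ultimately show "A \<preceq>\<^sub>L ?P" "?P \<preceq>\<^sub>L B"
    using symP sym_pos_def_symmetric[OF A] sym_pos_def_symmetric[OF B] by (auto simp: loewner_le_iff)
qed

section \<open>Covariance of the recentred measure\<close>

context sandwiched_potential
begin

lemma integrable_component_product:
  "integrable N (\<lambda>y. (y $ i - a) * (y $ j - b))"
proof -
  have "(\<lambda>y. (y $ i - a) * (y $ j - b)) = (\<lambda>y. (axis i 1 \<bullet> y) * (axis j 1 \<bullet> y)
      - b * (axis i 1 \<bullet> y) - a * (axis j 1 \<bullet> y) + a * b)"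
    by (simp add: inner_axis' algebra_simps)
  then show ?thesis by simp
qed

definition covariance :: "real^'d^'d"
  where "covariance = (\<chi> i j. \<integral>y. (y $ i - \<mu> $ i) * (y $ j - \<mu> $ j) \<partial>N)"

lemma quad_covariance: "quad covariance w = variance_along w"
proof -
  have "variance_along w = (\<integral>y. (\<Sum>i\<in>UNIV. \<Sum>j\<in>UNIV. w $ i * w $ j * ((y $ i - \<mu> $ i) * (y $ j - \<mu> $ j))) \<partial>N)"
  proof -
    have "w \<bullet> y - w \<bullet> \<mu> = (\<Sum>i\<in>UNIV. w $ i * (y $ i - \<mu> $ i))" for y
      by (simp add: inner_vec_def sum_subtractf right_diff_distrib)
    then show ?thesis
      unfolding variance_along_def by (simp add: power2_eq_square sum_product mult_ac)
  qed
  also have "\<dots> = (\<Sum>i\<in>UNIV. \<Sum>j\<in>UNIV. w $ i * w $ j * (\<integral>y. (y $ i - \<mu> $ i) * (y $ j - \<mu> $ j) \<partial>N))"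
    by (simp add: Bochner_Integration.integral_sum integrable_component_product)
  also have "\<dots> = quad covariance w"
    by (simp add: quad_def covariance_def inner_vec_def matrix_vector_mult_def sum_distrib_left mult_ac)
  finally show ?thesis by simp
qed

lemma covariance_pos_def: "sym_pos_def covariance"
  unfolding sym_pos_def_def
proof (intro conjI allI impI)
  show "symmetric_matrix covariance"
    by (simp add: symmetric_matrix_def covariance_def transpose_def vec_eq_iff mult.commute)
  fix w :: "real^'d" assume "w \<noteq> 0"
  define Q where "Q = quad Ap w"
  \<comment> \<open>The maximiser of 2 r (w . w) - r^2 Q, so that \<open>cramer_rao\<close> gives a
    strictly positive lower bound of the variance.\<close>
  define r where "r = (w \<bullet> w) / Q"
  have Q: "0 < Q" unfolding Q_def using Ap \<open>w \<noteq> 0\<close> by (rule quad_pos)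
  have "0 < (w \<bullet> w)\<^sup>2 / Q" using Q \<open>w \<noteq> 0\<close> by simp
  also have "\<dots> = 2 * (w \<bullet> (r *\<^sub>R w)) - quad Ap (r *\<^sub>R w)"
    using Q unfolding quad_scaleR Q_def[symmetric] by (simp add: r_def power2_eq_square)
  also have "\<dots> \<le> quad covariance w" unfolding quad_covariance by (rule cramer_rao)
  finally show "0 < w \<bullet> (covariance *v w)" by (simp add: quad_def)
qed

lemma inverse_covariance_bounds: "Am \<preceq>\<^sub>L matrix_inv covariance" "matrix_inv covariance \<preceq>\<^sub>L Ap"
  by (rule loewner_matrix_inv_le[OF covariance_pos_def Am Ap];
      simp add: quad_covariance cramer_rao brascamp_lieb)+

text \<open>The constant Z need not be computed: comparing total masses of two probability measures
  forces it to equal \<open>K\<close>.\<close>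

lemma translated_measure:
  assumes M: "prob_space M" "M = density lborel (\<lambda>x. ennreal (p x))"
    and p: "\<And>y. p (x0 + y) = exp (- u y) / Z" and "0 < Z"
  shows "M = distr N borel (\<lambda>y. x0 + y)"
proof -
  have "(\<lambda>x. p (x0 + (x - x0))) \<in> borel_measurable borel" unfolding p by measurable
  then have [measurable]: "p \<in> borel_measurable borel" by simp
  have "M = density (distr lborel borel ((+) x0)) (\<lambda>x. ennreal (p x))"
    by (simp add: M(2) lborel_distr_plus)
  also have "\<dots> = distr (density lborel (\<lambda>y. ennreal (p (x0 + y)))) borel ((+) x0)"
    by (rule density_distr) measurable
  finally have M': "M = distr (density lborel (\<lambda>y. ennreal (exp (- u y) / Z))) borel ((+) x0)"
    by (simp add: p)
  have "1 = emeasure M (space M)" using prob_space.emeasure_space_1[OF M(1)] by simp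
  also have "\<dots> = (\<integral>\<^sup>+y. ennreal (exp (- u y) / Z) \<partial>lborel)"
    unfolding M' by (simp add: emeasure_distr emeasure_density)
  also have "\<dots> = ennreal (K / Z)"
    unfolding K_def using \<open>0 < Z\<close> integrable_exp_u by (subst nn_integral_eq_integral) auto
  finally have "K = Z" using \<open>0 < Z\<close> K_pos by (simp flip: ennreal_1)
  then show ?thesis using M' by (simp add: N_def)
qed

lemma mean_translated:
  "mean_vector (distr N borel (\<lambda>y. x0 + y)) = x0 + \<mu>"
  unfolding mean_vector_def by (subst integral_distr) (simp_all add: integrable_id \<mu>_def)

lemma covariance_translated:
  "covariance_matrix (distr N borel (\<lambda>y. x0 + y)) = covariance"
  unfolding covariance_matrix_def covariance_def mean_translated
  by (subst integral_distr) (simp_all add: algebra_simps)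

end

section \<open>Recentring at the mode and comparison of the rank-one corrections\<close>

theorem proposition9:
  fixes M :: "(real^'d) measure"
    and \<pi> U :: "real^'d \<Rightarrow> real"
    and xs \<mu> :: "real^'d"
    and S \<Delta>p \<Delta>m Dp Dm Pp Pm :: "real^'d^'d"
    and c :: real
  assumes "prob_space M"
    and "M = density lborel (\<lambda>x. ennreal (\<pi> x))"
    and "\<exists>Z>0. \<forall>x. \<pi> x = exp (- U x) / Z"
    and "C2 U"
    and "S = covariance_matrix M"
    and "\<mu> = mean_vector M"
    and "\<forall>x. \<pi> x \<le> \<pi> xs"
    and "sym_pos_def \<Delta>p" and "sym_pos_def \<Delta>m"
    and "\<forall>x. \<Delta>m \<preceq>\<^sub>L hessian U x \<and> hessian U x \<preceq>\<^sub>L \<Delta>p"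
    and "1 - (xs - \<mu>) \<bullet> (\<Delta>p *v (xs - \<mu>)) > 0"
    and "Dp = \<Delta>p ** outer_product (xs - \<mu>) (xs - \<mu>)"
    and "Dm = \<Delta>m ** outer_product (xs - \<mu>) (xs - \<mu>)"
    and "c = sqrt (det \<Delta>m * det (matrix_inv \<Delta>p))"
    and "Pp = inverse c *\<^sub>R ((mat 1 + inverse (1 - trace Dp) *\<^sub>R Dp) ** \<Delta>p)"
    and "Pm = c *\<^sub>R ((mat 1 + inverse (1 - trace Dm) *\<^sub>R Dm) ** \<Delta>m)"
  shows "c \<le> 1 \<and>
    Pm \<preceq>\<^sub>L matrix_inv S \<and> matrix_inv S \<preceq>\<^sub>L Pp \<and>
    (\<forall>x. op_norm (hessian U x - matrix_inv S) \<le> max (op_norm (\<Delta>p - Pm)) (op_norm (Pp - \<Delta>m)))"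
proof -
  note spd = assms(8,9)
  note sym = spd[THEN sym_pos_def_symmetric]
  obtain Z where Z: "0 < Z" "\<And>x. \<pi> x = exp (- U x) / Z" using assms(3) by blast
  have min: "U xs \<le> U x" for x using assms(7) Z by (simp add: divide_le_cancel)
  \<comment> \<open>In these coordinates the mode is 0 and the mean is -m; quadratic forms do not
    see the sign.\<close>
  define u where "u y = U (xs + y) - U xs" for y
  define g where "g y = gradient U (xs + y)" for y
  have cont: "continuous_on UNIV U"
    using assms(4) by (auto simp: C2_def intro!: continuous_at_imp_continuous_on differentiable_imp_continuous_within)
  interpret P: sandwiched_potential u g \<Delta>m \<Delta>p
  proof
    show "u \<in> borel_measurable borel"
      unfolding u_def using borel_measurable_continuous_onI[OF cont] by measurable
    show "g 0 = 0" using gradient_zero_at_minimum[OF assms(4) min] by (simp add: g_def)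
    show "u y + g y \<bullet> h + quad \<Delta>m h / 2 \<le> u (y + h)" "u (y + h) \<le> u y + g y \<bullet> h + quad \<Delta>p h / 2" for y h
      using taylor_bounds[OF assms(4), of \<Delta>m \<Delta>p "xs + y" h] assms(10)
      by (simp_all add: u_def g_def add.assoc)
  qed (simp_all add: spd u_def)
  have \<pi>u: "\<pi> (xs + y) = exp (- u y) / (Z * exp (U xs))" for y
  proof -
    have "exp (- u y) = exp (U xs) * exp (- U (xs + y))" by (simp add: u_def flip: exp_add)
    then show ?thesis by (simp add: Z(2))
  qed
  have M: "M = distr P.N borel (\<lambda>y. xs + y)"
    by (rule P.translated_measure[OF assms(1,2) \<pi>u]) (use Z in simp)
  define m where "m = xs - \<mu>"
  have S: "S = P.covariance" and m: "m = - P.\<mu>"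
    using assms(5,6) by (simp_all add: M P.covariance_translated P.mean_translated m_def)
  have c: "c = P.c"
    unfolding assms(14) P.c_def using gauss_integral_ratio[OF spd(2,1)] gauss_integral_pos[OF spd(2)]
    by (simp add: det_matrix_inv[OF spd(1)])
  have m1: "quad \<Delta>p m < 1" using assms(11) by (simp add: quad_def m_def)
  have m0: "0 \<le> quad \<Delta>m m" "quad \<Delta>m m \<le> 1 - c" "quad \<Delta>m m < 1"
    using P.mean_bound m1 P.quad_Am_le_Ap[of m] quad_nonneg[OF spd(2), of m] by (auto simp: m c)
  have c01: "0 < c" "c \<le> 1" using P.c_pos P.c_le_1 by (simp_all add: c)
  have inv: "\<Delta>m \<preceq>\<^sub>L matrix_inv S" "matrix_inv S \<preceq>\<^sub>L \<Delta>p"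
    unfolding S by (rule P.inverse_covariance_bounds)+
  have Pp: "Pp = inverse c *\<^sub>R ((mat 1 + inverse (1 - quad \<Delta>p m) *\<^sub>R (\<Delta>p ** outer_product m m)) ** \<Delta>p)"
    using assms(12,15) by (simp add: m_def trace_outer)
  have Pm: "Pm = c *\<^sub>R ((mat 1 + inverse (1 - quad \<Delta>m m) *\<^sub>R (\<Delta>m ** outer_product m m)) ** \<Delta>m)"
    using assms(13,16) by (simp add: m_def trace_outer)
  have "quad \<Delta>p v \<le> quad Pp v" for v
  proof -
    \<comment> \<open>Both changes enlarge the form: c is at most 1, and the coefficient of the
      square is positive by \<open>m1\<close>.\<close>
    have "1 * quad \<Delta>p v \<le> inverse c * (quad \<Delta>p v + inverse (1 - quad \<Delta>p m) * (v \<bullet> (\<Delta>p *v m))\<^sup>2)"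
      using c01 m1 quad_nonneg[OF spd(1), of v] by (intro mult_mono) (auto simp: one_le_inverse_iff)
    then show ?thesis by (simp add: Pp rank_one_update(2)[OF sym(1)])
  qed
  then have Pp_ge: "\<Delta>p \<preceq>\<^sub>L Pp"
    using sym(1) rank_one_update(1)[OF sym(1)] by (simp add: loewner_le_iff Pp)
  have "quad Pm v \<le> quad \<Delta>m v" for v
  proof -
    let ?t = "quad \<Delta>m m"
    \<comment> \<open>Cauchy-Schwarz for the form of \<open>\<Delta>m\<close> bounds the correction
      by t / (1 - t) times the form itself. Since 1 + t / (1 - t) = 1 / (1 - t), the total factor is
      c / (1 - t), which \<open>m0\<close> keeps at most 1.\<close>
    have "c * (quad \<Delta>m v + inverse (1 - ?t) * (v \<bullet> (\<Delta>m *v m))\<^sup>2)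
      \<le> c * (quad \<Delta>m v + inverse (1 - ?t) * (quad \<Delta>m v * ?t))"
      using c01 m0 quad_cauchy_schwarz[OF spd(2), of v m]
      by (intro mult_left_mono add_left_mono) auto
    also have "\<dots> = (c / (1 - ?t)) * quad \<Delta>m v"
      using m0 by (simp add: field_simps)
    also have "\<dots> \<le> 1 * quad \<Delta>m v"
      using m0 quad_nonneg[OF spd(2), of v] by (intro mult_right_mono) auto
    finally show ?thesis by (simp add: Pm rank_one_update(2)[OF sym(2)])
  qed
  then have Pm_le: "Pm \<preceq>\<^sub>L \<Delta>m"
    using sym(2) rank_one_update(1)[OF sym(2)] by (simp add: loewner_le_iff Pm)
  have sandwich: "Pm \<preceq>\<^sub>L matrix_inv S" "matrix_inv S \<preceq>\<^sub>L Pp"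
    using inv Pp_ge Pm_le by (auto simp: loewner_le_iff intro: order_trans)
  then show ?thesis
    using c01 assms(10) op_norm_diff_le by blast
qed

end
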